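(* Let $\mathbf{f}\in C_c^\infty(S^2;\mathbb{D})$ be a symmetric $2$-tensor field. Then $\mathbf{f}$ can be recovered from either of the following two combinations of data: (a) $\mathcal{L}\mathbf{f}$, $\mathcal{L}^1\mathbf{f}$, $\mathcal{L}^2\mathbf{f}$; (b) $\mathcal{T}\mathbf{f}$, $\mathcal{T}^1\mathbf{f}$, $\mathcal{T}^2\mathbf{f}$. That is, each combination uniquely determines $\mathbf{f}$: for $\mathbf{f},\mathbf{h}\in C_c^\infty(S^2;\mathbb{D})$, (a) if $\mathcal{L}^k\mathbf{f}(s,\theta)=\mathcal{L}^k\mathbf{h}(s,\theta)$ for $k=0,1,2$ and all $s\in\mathbb{R}$, $\theta\in[0,2\pi)$, then $\mathbf{f}=\mathbf{h}$; and (b) if $\mathcal{T}^k\mathbf{f}(s,\theta)=\mathcal{T}^k\mathbf{h}(s,\theta)$ for $k=0,1,2$ and all $s\in\mathbb{R}$, $\theta\in[0,2\pi)$, then $\mathbf{f}=\mathbf{h}$.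
   Context: Let $\mathbb{D}\subseteq\mathbb{R}^2$ be the (open) unit disk. $C_c^\infty(S^2;\mathbb{D})$ denotes the space of symmetric $2$-tensor fields $\mathbf{f}=(f_{ij})_{1\le i,j\le 2}$, $f_{12}=f_{21}$, whose components are smooth compactly supported functions on $\mathbb{D}$, extended by zero to $\mathbb{R}^2$. Fix constants $w_0>0$ and $\lambda>0$, and put $z_R=\pi w_0^2/\lambda$ and $w(u)=w_0\sqrt{1+(u/z_R)^2}$ for $u\in\mathbb{R}$. The Gaussian beam kernel is $$K(x_1,x_2)=\frac{w_0}{w(x_2)}\exp\left(-\frac{x_1^2}{w^2(x_2)}\right).$$ For an angle $\theta\in[0,2\pi)$ write $\boldsymbol{\theta}=(\theta_1,\theta_2)=(\cos\theta,\sin\theta)$ and $\boldsymbol{\theta}^\perp=(\theta_1^\perp,\theta_2^\perp)=(-\sin\theta,\cos\theta)$. For an integer $k\ge0$, $s\in\mathbb{R}$ and $\theta\in[0,2\pi)$ define the $k$-th moment longitudinal and transverse Gaussian beam Radon transforms $$\mathcal{L}^k\mathbf{f}(s,\theta)=\int_{\mathbb{R}^2}(\boldsymbol{\theta}^\perp\cdot\mathbf{x})^k\,K(s-\boldsymbol{\theta}\cdot\mathbf{x},\,\boldsymbol{\theta}^\perp\cdot\mathbf{x})\sum_{i,j=1}^2\theta_i^\perp\theta_j^\perp f_{ij}(\mathbf{x})\,d\mathbf{x},$$ $$\mathcal{T}^k\mathbf{f}(s,\theta)=\int_{\mathbb{R}^2}(\boldsymbol{\theta}^\perp\cdot\mathbf{x})^k\,K(s-\boldsymbol{\theta}\cdot\mathbf{x},\,\boldsymbol{\theta}^\perp\cdot\mathbf{x})\sum_{i,j=1}^2\theta_i\theta_j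 f_{ij}(\mathbf{x})\,d\mathbf{x},$$ and write $\mathcal{L}=\mathcal{L}^0$, $\mathcal{T}=\mathcal{T}^0$. *)

theory Defs
  imports "HOL-Analysis.Analysis"
begin

text \<open>Meant for open \<open>S\<close>: iterated Frechet derivatives along fixed directions. For finite-dimensional
  domains \<open>higher_differentiable_on S f n\<close> says that \<open>f\<close> is \<open>C\<^sup>n\<close> on \<open>S\<close>.\<close>

primrec higher_differentiable_on ::
    "'a::real_normed_vector set \<Rightarrow> ('a \<Rightarrow> 'b::real_normed_vector) \<Rightarrow> nat \<Rightarrow> bool" where
  "higher_differentiable_on S f 0 \<longleftrightarrow> continuous_on S f"
| "higher_differentiable_on S f (Suc n) \<longleftrightarrow>
     (\<forall>x\<in>S. f differentiable (at x)) \<and>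
     (\<forall>v. higher_differentiable_on S (\<lambda>x. frechet_derivative f (at x) v) n)"

definition smooth_on :: "'a::real_normed_vector set \<Rightarrow> ('a \<Rightarrow> 'b::real_normed_vector) \<Rightarrow> bool" where
  "smooth_on S f \<longleftrightarrow> (\<forall>n. higher_differentiable_on S f n)"

definition unit_disk :: "(real^2) set" where
  "unit_disk = ball 0 1"

text \<open>Functions in \<open>C\<^sub>c\<^sup>\<infinity>(D)\<close> are total functions on the plane; the extension by zero is enforced by
  requiring the support, taken in the whole plane, to lie inside \<open>D\<close>.\<close>

definition test_function_on :: "(real^2) set \<Rightarrow> (real^2 \<Rightarrow> real) \<Rightarrow> bool" where
  "test_function_on D g \<longleftrightarrow>
     smooth_on D g \<and> compact (closure {x. g x \<noteq> 0}) \<and> closure {x. g x \<noteq> 0} \<subseteq> D"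

definition symmetric_tensor_fields :: "(real^2) set \<Rightarrow> (real^2 \<Rightarrow> real^2^2) set" where
  "symmetric_tensor_fields D =
     {f. (\<forall>x i j. f x $ i $ j = f x $ j $ i) \<and> (\<forall>i j. test_function_on D (\<lambda>x. f x $ i $ j))}"

definition rayleigh_range :: "real \<Rightarrow> real \<Rightarrow> real" where
  "rayleigh_range w0 lam = pi * w0\<^sup>2 / lam"

definition beam_width :: "real \<Rightarrow> real \<Rightarrow> real \<Rightarrow> real" where
  "beam_width w0 lam u = w0 * sqrt (1 + (u / rayleigh_range w0 lam)\<^sup>2)"

definition beam_kernel :: "real \<Rightarrow> real \<Rightarrow> real \<Rightarrow> real \<Rightarrow> real" where
  "beam_kernel w0 lam x1 x2 =
     w0 / beam_width w0 lam x2 * exp (- (x1\<^sup>2 / (beam_width w0 lam x2)\<^sup>2))"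

definition dir :: "real \<Rightarrow> real^2" where
  "dir \<theta> = vector [cos \<theta>, sin \<theta>]"

definition dir_perp :: "real \<Rightarrow> real^2" where
  "dir_perp \<theta> = vector [- sin \<theta>, cos \<theta>]"

definition longitudinal_transform ::
    "real \<Rightarrow> real \<Rightarrow> nat \<Rightarrow> (real^2 \<Rightarrow> real^2^2) \<Rightarrow> real \<Rightarrow> real \<Rightarrow> real" where
  "longitudinal_transform w0 lam k f s \<theta> =
     (LINT x|lborel. (dir_perp \<theta> \<bullet> x) ^ k
        * beam_kernel w0 lam (s - dir \<theta> \<bullet> x) (dir_perp \<theta> \<bullet> x)
        * (\<Sum>i\<in>UNIV. \<Sum>j\<in>UNIV. dir_perp \<theta> $ i * dir_perp \<theta> $ j * f x $ i $ j))"

definition transverse_transform ::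
    "real \<Rightarrow> real \<Rightarrow> nat \<Rightarrow> (real^2 \<Rightarrow> real^2^2) \<Rightarrow> real \<Rightarrow> real \<Rightarrow> real" where
  "transverse_transform w0 lam k f s \<theta> =
     (LINT x|lborel. (dir_perp \<theta> \<bullet> x) ^ k
        * beam_kernel w0 lam (s - dir \<theta> \<bullet> x) (dir_perp \<theta> \<bullet> x)
        * (\<Sum>i\<in>UNIV. \<Sum>j\<in>UNIV. dir \<theta> $ i * dir \<theta> $ j * f x $ i $ j))"

end

theory Submission
  imports Defs "HOL-Probability.Distributions" "HOL-Computational_Algebra.Polynomial"
begin

text \<open>
  By linearity the claim is that a tensor field \<open>g\<close> with zero data vanishes. For a direction
  \<open>\<theta>\<close> write \<open>a = dir \<theta> \<bullet> x\<close>, \<open>b = dir_perp \<theta> \<bullet> x\<close>, and let \<open>F\<^sub>\<theta>\<close> be the component of \<open>g\<close> that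
  enters the longitudinal transform. Turning a symmetric tensor by a right angle, that is, replacing
  \<open>(g\<^sub>1\<^sub>1, g\<^sub>1\<^sub>2, g\<^sub>2\<^sub>2)\<close> by \<open>(g\<^sub>2\<^sub>2, - g\<^sub>1\<^sub>2, g\<^sub>1\<^sub>1)\<close>, exchanges the two transforms, so the longitudinal case
  suffices.

  The squared width of the beam is \<open>w0\<^sup>2 + 4 c b\<^sup>2\<close> with \<open>c = (w0 / (2 z\<^sub>R))\<^sup>2\<close>. A Laplace transform in
  \<open>s\<close> therefore turns the kernel into a constant times \<open>exp (t a + c t\<^sup>2 b\<^sup>2)\<close>, and this is the average
  of \<open>exp (t (a + y b))\<close> over a centred Gaussian variable \<open>y\<close> of variance \<open>2 c\<close>. The moments
  \<open>k = 0, 1, 2\<close> of the transform correspond to averages weighted with \<open>1, y, y\<^sup>2\<close>. Comparing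
  powers of \<open>t\<close>, the average of \<open>y\<^sup>k (a + y b)\<^sup>d\<close> integrates to zero against \<open>F\<^sub>\<theta>\<close> for every \<open>d\<close>
  and \<open>k \<le> 2\<close> (\<open>gaussian_averaged_moments_zero\<close>).

  Put \<open>z = x\<^sub>1 + \<i> x\<^sub>2\<close>, \<open>A = g\<^sub>1\<^sub>1 - g\<^sub>2\<^sub>2 + 2 \<i> g\<^sub>1\<^sub>2\<close> and \<open>C = g\<^sub>1\<^sub>1 + g\<^sub>2\<^sub>2\<close>. Since \<open>a + y b\<close> is the real part of
  \<open>(1 - \<i> y) cis (- \<theta>) z\<close> and \<open>F\<^sub>\<theta>\<close> only contains the frequencies \<open>0\<close> and \<open>\<plusminus> 2\<close> in \<open>\<theta>\<close>, a Fourier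
  coefficient in \<open>\<theta>\<close> involves exactly three moments, all of total degree \<open>d = p + q + 2\<close>: those of
  \<open>A\<close>, \<open>C\<close> and \<open>cnj A\<close> at the exponents \<open>(p, q + 2)\<close>, \<open>(p + 1, q + 1)\<close> and \<open>(p + 2, q)\<close> of \<open>z\<close> and \<open>cnj z\<close>.
  The relations between them (\<open>tensor_moment_relations\<close>) say that a quadratic polynomial \<open>P\<close> whose
  coefficients encode these moments is orthogonal to \<open>1, y, y\<^sup>2\<close> for the complex weight
  \<open>exp (- y\<^sup>2 / (4 c)) (1 - \<i> y)\<^sup>p (1 + \<i> y)\<^sup>q\<close>. For \<open>p = q\<close> the weight is positive and \<open>P = 0\<close> is
  immediate. In general the weight is a power of \<open>1 + y\<^sup>2\<close> times a power of \<open>1 \<plusminus> \<i> y\<close>, where the second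
  exponent \<open>\<bar>p - q\<bar>\<close> is kept fixed. The real part of the second factor has a constant sign far from the
  origin, and a high power of \<open>1 + y\<^sup>2\<close> moves the mass of the integral there. So the integral of the weight
  against \<open>\<bar>P\<bar>\<^sup>2\<close>, which is zero by orthogonality, has a real part of that sign unless \<open>P = 0\<close>
  (\<open>gaussian_quadratic_orthogonality\<close>).

  Thus, for each fixed difference of the exponents, all but finitely many moments of \<open>A\<close> and of \<open>C\<close>
  vanish. The Weierstrass approximation theorem, applied after multiplication with a radial cutoff that
  is zero near the origin, gives \<open>A = C = 0\<close> (\<open>continuous_eq_0_if_high_plane_moments_zero\<close>).
\<close>

section \<open>Gaussian integrals\<close>

text \<open>
  Completing the square moves the mean by \<open>t v / 2\<close> and leaves the variance \<open>v / 2\<close> unchanged, so all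
  exponential moments reduce to moments of a normal density.
\<close>

lemma exp_times_gaussian_eq_normal_density:
  fixes t a v s :: real
  assumes "v > 0"
  shows "exp (t * s) * exp (- ((s - a)\<^sup>2 / v)) =
    sqrt (pi * v) * exp (t * a + t\<^sup>2 * v / 4) * normal_density (a + t * v / 2) (sqrt (v / 2)) s"
proof -
  have e: "t * s - (s - a)\<^sup>2 / v = t * a + t\<^sup>2 * v / 4 - (s - (a + t * v / 2))\<^sup>2 / v"
    using assms by (simp add: field_simps power2_eq_square)
  have nd: "normal_density (a + t * v / 2) (sqrt (v / 2)) s =
      1 / sqrt (pi * v) * exp (- ((s - (a + t * v / 2))\<^sup>2 / v))"
    using assms by (simp add: normal_density_def)
  have "exp (t * s) * exp (- ((s - a)\<^sup>2 / v)) = exp (t * s - (s - a)\<^sup>2 / v)"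
    by (simp only: exp_add[symmetric] diff_conv_add_uminus)
  also have "\<dots> = exp (t * a + t\<^sup>2 * v / 4) * exp (- ((s - (a + t * v / 2))\<^sup>2 / v))"
    unfolding e by (simp only: exp_add[symmetric] diff_conv_add_uminus)
  also have "\<dots> = sqrt (pi * v) * exp (t * a + t\<^sup>2 * v / 4) * normal_density (a + t * v / 2) (sqrt (v / 2)) s"
    unfolding nd using assms by simp
  finally show ?thesis .
qed

lemma laplace_gaussian:
  fixes t a v :: real
  assumes "v > 0"
  shows "has_bochner_integral lborel (\<lambda>s. exp (t * s) * exp (- ((s - a)\<^sup>2 / v)))
    (sqrt (pi * v) * exp (t * a + t\<^sup>2 * v / 4))"
proof -
  have "has_bochner_integral lborel (normal_density (a + t * v / 2) (sqrt (v / 2))) 1"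
    using assms by (simp add: has_bochner_integral_iff)
  from has_bochner_integral_mult_right[OF this, where c = "sqrt (pi * v) * exp (t * a + t\<^sup>2 * v / 4)"]
  show ?thesis
    by (simp only: exp_times_gaussian_eq_normal_density[OF assms] mult_1_right)
qed

text \<open>
  The density of a centred normal variable with variance \<open>2 c\<close>, without its normalising factor.
\<close>

definition gauss_weight :: "real \<Rightarrow> real \<Rightarrow> real" where
  "gauss_weight c y = exp (- (y\<^sup>2 / (4 * c)))"

lemma gauss_weight_pos [simp]: "gauss_weight c y > 0" "gauss_weight c y \<ge> 0"
  by (simp_all add: gauss_weight_def)

lemma continuous_on_gauss_weight [continuous_intros]: "c > 0 \<Longrightarrow> continuous_on S (gauss_weight c)"
  unfolding gauss_weight_def by (intro continuous_intros) auto

lemma borel_measurable_gauss_weight [measurable]: "gauss_weight c \<in> borel_measurable borel"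
  unfolding gauss_weight_def by measurable

lemma gauss_weight_times_exp:
  assumes "c > 0"
  shows "gauss_weight c y * exp (t * y) =
    sqrt (4 * pi * c) * exp (c * t\<^sup>2) * normal_density (2 * c * t) (sqrt (2 * c)) y"
proof -
  have e: "pi * (4 * c) = 4 * pi * c" "t * 0 + t\<^sup>2 * (4 * c) / 4 = c * t\<^sup>2"
      "0 + t * (4 * c) / 2 = 2 * c * t" "4 * c / 2 = 2 * c" "y - 0 = y" for y :: real
    by simp_all
  have "exp (t * y) * exp (- ((y - 0)\<^sup>2 / (4 * c))) =
      sqrt (pi * (4 * c)) * exp (t * 0 + t\<^sup>2 * (4 * c) / 4)
        * normal_density (0 + t * (4 * c) / 2) (sqrt (4 * c / 2)) y"
    by (rule exp_times_gaussian_eq_normal_density) (use assms in simp)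
  then show ?thesis
    unfolding gauss_weight_def e by (simp only: mult.commute)
qed

text \<open>
  For \<open>k = 0, 1, 2\<close> this is the integral of \<open>y\<^sup>k exp (t y)\<close> against the Gaussian weight, that is, the
  \<open>k\<close>-th derivative in \<open>t\<close> of \<open>exp (c t\<^sup>2)\<close> up to the normalising factor; larger \<open>k\<close> do not occur.
\<close>

definition gauss_exp_moment :: "real \<Rightarrow> nat \<Rightarrow> real \<Rightarrow> real" where
  "gauss_exp_moment c k t = sqrt (4 * pi * c) * exp (c * t\<^sup>2) *
     (if k = 0 then 1 else if k = 1 then 2 * c * t else 2 * c + 4 * c\<^sup>2 * t\<^sup>2)"

lemma has_integral_gauss_exp_moment:
  assumes "c > 0" "k \<in> {0, 1, 2}"
  shows "has_bochner_integral lborel (\<lambda>y. y ^ k * gauss_weight c y * exp (t * y))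
           (gauss_exp_moment c k t)"
proof -
  define \<mu> \<sigma> where "\<mu> = 2 * c * t" and "\<sigma> = sqrt (2 * c)"
  have \<sigma>: "\<sigma> > 0" "\<sigma>\<^sup>2 = 2 * c" using assms by (auto simp: \<sigma>_def)
  have eq: "gauss_weight c y * exp (t * y) = sqrt (4 * pi * c) * exp (c * t\<^sup>2) * normal_density \<mu> \<sigma> y" for y
    unfolding \<mu>_def \<sigma>_def by (rule gauss_weight_times_exp[OF assms(1)])
  have m0: "has_bochner_integral lborel (\<lambda>y. normal_density \<mu> \<sigma> y) 1"
    using \<sigma> by (simp add: has_bochner_integral_iff)
  have m1: "has_bochner_integral lborel (\<lambda>y. normal_density \<mu> \<sigma> y * y) \<mu>"
    by (rule normal_moment_nz_1[OF \<sigma>(1)])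
  have m2': "has_bochner_integral lborel (\<lambda>y. normal_density \<mu> \<sigma> y * (y - \<mu>) ^ 2) (2 * c)"
    using normal_moment_even[OF \<sigma>(1), of \<mu> 1] \<sigma> by simp
  have m2: "has_bochner_integral lborel (\<lambda>y. normal_density \<mu> \<sigma> y * y\<^sup>2) (2 * c + \<mu>\<^sup>2)"
    using has_bochner_integral_add[OF m2' has_bochner_integral_diff[OF
       has_bochner_integral_mult_right[OF m1, where c = "2 * \<mu>"] has_bochner_integral_mult_right[OF m0, where c = "\<mu>\<^sup>2"]]]
    by (simp add: algebra_simps power2_eq_square)
  have gem: "gauss_exp_moment c k t = sqrt (4 * pi * c) * exp (c * t\<^sup>2) *
      (if k = 0 then 1 else if k = 1 then \<mu> else 2 * c + \<mu>\<^sup>2)"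
    by (simp add: gauss_exp_moment_def \<mu>_def power_mult_distrib)
  have "has_bochner_integral lborel (\<lambda>y. normal_density \<mu> \<sigma> y * y ^ k)
      (if k = 0 then 1 else if k = 1 then \<mu> else 2 * c + \<mu>\<^sup>2)"
    using assms(2) m0 m1 m2 by auto
  from has_bochner_integral_mult_right[OF this, where c = "sqrt (4 * pi * c) * exp (c * t\<^sup>2)"]
  have "has_bochner_integral lborel
      (\<lambda>y. sqrt (4 * pi * c) * exp (c * t\<^sup>2) * (normal_density \<mu> \<sigma> y * y ^ k)) (gauss_exp_moment c k t)"
    unfolding gem .
  also have "(\<lambda>y. sqrt (4 * pi * c) * exp (c * t\<^sup>2) * (normal_density \<mu> \<sigma> y * y ^ k)) =
      (\<lambda>y. y ^ k * gauss_weight c y * exp (t * y))"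
    by (rule ext) (simp only: mult.assoc eq, simp only: mult_ac)
  finally show ?thesis .
qed

lemma integrable_gauss_weight_polynomial_growth:
  fixes f :: "real \<Rightarrow> 'b :: {banach, second_countable_topology}"
  assumes "c > 0" and [measurable]: "f \<in> borel_measurable borel"
    and bound: "\<And>y. norm (f y) \<le> B * (1 + \<bar>y\<bar>) ^ n"
  shows "integrable lborel (\<lambda>y. gauss_weight c y *\<^sub>R f y)"
proof -
  have eq: "gauss_weight c y = sqrt (4 * pi * c) * normal_density 0 (sqrt (2 * c)) y" for y
    using gauss_weight_times_exp[OF assms(1), of y 0] by simp
  have "integrable lborel (\<lambda>y. normal_density 0 (sqrt (2 * c)) y * \<bar>y\<bar> ^ k)" for k
    using integrable_normal_moment_abs[of "sqrt (2 * c)" 0 k] assms(1) by simp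
  then have "integrable lborel (\<lambda>y. (sqrt (4 * pi * c) * B * of_nat (n choose k)) *
      (normal_density 0 (sqrt (2 * c)) y * \<bar>y\<bar> ^ k))" for k
    by simp
  then have "integrable lborel (\<lambda>y. \<Sum>k\<le>n. (sqrt (4 * pi * c) * B * of_nat (n choose k)) *
      (normal_density 0 (sqrt (2 * c)) y * \<bar>y\<bar> ^ k))"
    by (rule Bochner_Integration.integrable_sum)
  also have "(\<lambda>y. \<Sum>k\<le>n. (sqrt (4 * pi * c) * B * of_nat (n choose k)) *
      (normal_density 0 (sqrt (2 * c)) y * \<bar>y\<bar> ^ k)) = (\<lambda>y. gauss_weight c y * (B * (1 + \<bar>y\<bar>) ^ n))"
    by (simp add: eq fun_eq_iff add.commute[of 1] binomial_ring sum_distrib_left mult_ac)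
  finally show ?thesis
  proof (rule Bochner_Integration.integrable_bound)
    show "AE y in lborel. norm (gauss_weight c y *\<^sub>R f y) \<le> norm (gauss_weight c y * (B * (1 + \<bar>y\<bar>) ^ n))"
    proof (rule AE_I2)
      fix y
      have "norm (f y) \<le> \<bar>B * (1 + \<bar>y\<bar>) ^ n\<bar>" using bound[of y] by linarith
      then show "norm (gauss_weight c y *\<^sub>R f y) \<le> norm (gauss_weight c y * (B * (1 + \<bar>y\<bar>) ^ n))"
        by (simp add: abs_mult mult_left_mono)
    qed
  qed measurable
qed

text \<open>
  A syntax-directed integrability criterion: products, sums and powers of functions with this property
  inherit it, and the Gaussian weight makes all of them integrable.
\<close>

definition polynomially_bounded :: "(real \<Rightarrow> 'b::real_normed_vector) \<Rightarrow> bool" where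
  "polynomially_bounded f \<longleftrightarrow> (\<exists>B n. \<forall>y. norm (f y) \<le> B * (1 + \<bar>y\<bar>) ^ n)"

lemma polynomially_boundedE:
  assumes "polynomially_bounded f"
  obtains B n where "B \<ge> 0" "\<And>y. norm (f y) \<le> B * (1 + \<bar>y\<bar>) ^ n"
proof -
  from assms obtain B n where *: "\<And>y. norm (f y) \<le> B * (1 + \<bar>y\<bar>) ^ n"
    unfolding polynomially_bounded_def by blast
  have "B \<ge> 0" using order_trans[OF norm_ge_zero *[of 0]] by simp
  with * show ?thesis by (rule that[rotated])
qed

lemma polynomially_bounded_intros:
  fixes f g :: "real \<Rightarrow> 'b::real_normed_algebra_1"
  shows "polynomially_bounded (\<lambda>y. z :: 'b)"
    and "polynomially_bounded (\<lambda>y. of_real y :: 'b)"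
    and "polynomially_bounded f \<Longrightarrow> polynomially_bounded g \<Longrightarrow> polynomially_bounded (\<lambda>y. f y + g y)"
    and "polynomially_bounded f \<Longrightarrow> polynomially_bounded g \<Longrightarrow> polynomially_bounded (\<lambda>y. f y - g y)"
    and "polynomially_bounded f \<Longrightarrow> polynomially_bounded g \<Longrightarrow> polynomially_bounded (\<lambda>y. f y * g y)"
proof -
  show "polynomially_bounded (\<lambda>y. z :: 'b)"
    unfolding polynomially_bounded_def by (rule exI[of _ "norm z"], rule exI[of _ 0]) simp
  show "polynomially_bounded (\<lambda>y. of_real y :: 'b)"
    unfolding polynomially_bounded_def by (rule exI[of _ 1], rule exI[of _ 1]) simp
  assume "polynomially_bounded f" "polynomially_bounded g"
  then obtain B C m n where B: "B \<ge> 0" "\<And>y. norm (f y) \<le> B * (1 + \<bar>y\<bar>) ^ m"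
    and C: "C \<ge> 0" "\<And>y. norm (g y) \<le> C * (1 + \<bar>y\<bar>) ^ n"
    by (metis polynomially_boundedE)
  have sum: "norm (f y) + norm (g y) \<le> (B + C) * (1 + \<bar>y\<bar>) ^ (m + n)" for y
  proof -
    have "(1 + \<bar>y\<bar>) ^ m \<le> (1 + \<bar>y\<bar>) ^ (m + n)" "(1 + \<bar>y\<bar>) ^ n \<le> (1 + \<bar>y\<bar>) ^ (m + n)"
      by (auto intro!: power_increasing)
    then have "B * (1 + \<bar>y\<bar>) ^ m \<le> B * (1 + \<bar>y\<bar>) ^ (m + n)" "C * (1 + \<bar>y\<bar>) ^ n \<le> C * (1 + \<bar>y\<bar>) ^ (m + n)"
      using B(1) C(1) by (auto intro!: mult_left_mono)
    then show ?thesis using B(2)[of y] C(2)[of y] by (simp add: distrib_right)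
  qed
  have "norm (f y + g y) \<le> (B + C) * (1 + \<bar>y\<bar>) ^ (m + n)" for y
    using sum[of y] norm_triangle_ineq[of "f y" "g y"] by linarith
  then show "polynomially_bounded (\<lambda>y. f y + g y)" unfolding polynomially_bounded_def by blast
  have "norm (f y - g y) \<le> (B + C) * (1 + \<bar>y\<bar>) ^ (m + n)" for y
    using sum[of y] norm_triangle_ineq4[of "f y" "g y"] by linarith
  then show "polynomially_bounded (\<lambda>y. f y - g y)" unfolding polynomially_bounded_def by blast
  have "norm (f y * g y) \<le> (B * C) * (1 + \<bar>y\<bar>) ^ (m + n)" for y
  proof -
    have "norm (f y * g y) \<le> norm (f y) * norm (g y)" by (rule norm_mult_ineq)
    also have "\<dots> \<le> (B * (1 + \<bar>y\<bar>) ^ m) * (C * (1 + \<bar>y\<bar>) ^ n)"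
      by (intro mult_mono B C) (use B in auto)
    finally show ?thesis by (simp add: power_add mult_ac)
  qed
  then show "polynomially_bounded (\<lambda>y. f y * g y)" unfolding polynomially_bounded_def by blast
qed

lemma polynomially_bounded_power:
  fixes f :: "real \<Rightarrow> 'b::real_normed_algebra_1"
  shows "polynomially_bounded f \<Longrightarrow> polynomially_bounded (\<lambda>y. f y ^ n)"
  by (induction n) (auto intro: polynomially_bounded_intros)

lemma integrable_gauss_weight:
  fixes f :: "real \<Rightarrow> 'b :: {banach, second_countable_topology}"
  assumes "c > 0" "continuous_on UNIV f" "polynomially_bounded f"
  shows "integrable lborel (\<lambda>y. gauss_weight c y *\<^sub>R f y)"
proof -
  obtain B n where "\<And>y. norm (f y) \<le> B * (1 + \<bar>y\<bar>) ^ n"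
    using polynomially_boundedE[OF assms(3)] by metis
  with assms show ?thesis
    by (intro integrable_gauss_weight_polynomial_growth borel_measurable_continuous_onI)
qed

section \<open>From beam data to Gaussian averages of plane waves\<close>

lemma integrable_continuous_vanishing_outside_ball:
  fixes f :: "'a :: euclidean_space \<Rightarrow> 'b :: {banach, second_countable_topology}"
  assumes "continuous_on UNIV f" and "\<And>x. norm x \<ge> 1 \<Longrightarrow> f x = 0"
  shows "integrable lborel f"
proof -
  have "integrable lborel (\<lambda>x. indicator (cball 0 1) x *\<^sub>R f x)"
    by (rule borel_integrable_compact) (auto intro: continuous_on_subset[OF assms(1)])
  also have "(\<lambda>x. indicator (cball 0 1) x *\<^sub>R f x) = f"
    using assms(2) by (auto simp: fun_eq_iff indicator_def)
  finally show ?thesis .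
qed

text \<open>
  The constant \<open>c\<close> for which the squared beam width at \<open>u\<close> is \<open>w0\<^sup>2 + 4 c u\<^sup>2\<close>.
\<close>

definition beam_spread :: "real \<Rightarrow> real \<Rightarrow> real" where
  "beam_spread w0 lam = (w0 / (2 * rayleigh_range w0 lam))\<^sup>2"

lemma beam_spread_pos:
  assumes "w0 > 0" "lam > 0"
  shows "beam_spread w0 lam > 0"
  using assms by (simp add: beam_spread_def rayleigh_range_def)

text \<open>
  The factor \<open>w0 / w\<close> of the kernel cancels the width of the Gaussian, so the position \<open>b\<close> along the beam
  survives only through the variance in the exponent.
\<close>

lemma laplace_beam_kernel:
  assumes "w0 > 0" "lam > 0"
  shows "has_bochner_integral lborel (\<lambda>s. exp (t * s) * beam_kernel w0 lam (s - a) b)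
     (w0 * sqrt pi * exp (t\<^sup>2 * w0\<^sup>2 / 4) * exp (t * a + beam_spread w0 lam * t\<^sup>2 * b\<^sup>2))"
proof -
  define w where "w = beam_width w0 lam b"
  have pos: "1 + (b / rayleigh_range w0 lam)\<^sup>2 > 0" by (simp add: add_pos_nonneg)
  have w: "w > 0" unfolding w_def beam_width_def using assms(1) pos by simp
  have w2: "w\<^sup>2 = w0\<^sup>2 + 4 * beam_spread w0 lam * b\<^sup>2"
    using pos by (simp add: w_def beam_width_def beam_spread_def power_mult_distrib power_divide distrib_left)
  have "has_bochner_integral lborel (\<lambda>s. w0 / w * (exp (t * s) * exp (- ((s - a)\<^sup>2 / w\<^sup>2))))
      (w0 / w * (sqrt (pi * w\<^sup>2) * exp (t * a + t\<^sup>2 * w\<^sup>2 / 4)))"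
    using w by (intro has_bochner_integral_mult_right laplace_gaussian) simp
  also have "(\<lambda>s. w0 / w * (exp (t * s) * exp (- ((s - a)\<^sup>2 / w\<^sup>2)))) =
      (\<lambda>s. exp (t * s) * beam_kernel w0 lam (s - a) b)"
    by (rule ext) (simp add: beam_kernel_def w_def)
  also have "w0 / w * (sqrt (pi * w\<^sup>2) * exp (t * a + t\<^sup>2 * w\<^sup>2 / 4)) = w0 * sqrt pi * exp (t * a + t\<^sup>2 * w\<^sup>2 / 4)"
    using w by (simp add: real_sqrt_mult)
  also have "t * a + t\<^sup>2 * w\<^sup>2 / 4 = t\<^sup>2 * w0\<^sup>2 / 4 + (t * a + beam_spread w0 lam * t\<^sup>2 * b\<^sup>2)"
    unfolding w2 by (simp add: field_simps)
  finally show ?thesis by (simp only: exp_add mult.assoc)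
qed

lemma beam_kernel_nonneg: "w0 > 0 \<Longrightarrow> beam_kernel w0 lam y b \<ge> 0"
  by (simp add: beam_kernel_def beam_width_def add_pos_nonneg)

text \<open>
  Fubini allows the Laplace transform in \<open>s\<close> to be taken under the integral over the plane; the factor
  that depends on \<open>t\<close> alone is nonzero and can be cancelled.
\<close>

lemma exponential_data_zero:
  fixes F a b :: "'a::euclidean_space \<Rightarrow> real"
  assumes w: "w0 > 0" "lam > 0"
    and F: "continuous_on UNIV F" "\<And>x. norm x \<ge> 1 \<Longrightarrow> F x = 0"
    and ab: "continuous_on UNIV a" "continuous_on UNIV b"
    and data: "\<And>s. (LINT x|lborel. b x ^ k * beam_kernel w0 lam (s - a x) (b x) * F x) = 0"
  shows "(LINT x|lborel. F x * b x ^ k * exp (t * a x + beam_spread w0 lam * t\<^sup>2 * (b x)\<^sup>2)) = 0"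
proof -
  define E where "E x = exp (t * a x + beam_spread w0 lam * t\<^sup>2 * (b x)\<^sup>2)" for x
  define C where "C = w0 * sqrt pi * exp (t\<^sup>2 * w0\<^sup>2 / 4)"
  define H where "H x s = F x * b x ^ k * (exp (t * s) * beam_kernel w0 lam (s - a x) (b x))" for x s
  have [measurable]: "F \<in> borel_measurable borel" "a \<in> borel_measurable borel" "b \<in> borel_measurable borel"
    using F ab by (auto intro: borel_measurable_continuous_onI)
  have hb: "has_bochner_integral lborel (\<lambda>s. exp (t * s) * beam_kernel w0 lam (s - a x) (b x)) (C * E x)" for x
    unfolding C_def E_def by (rule laplace_beam_kernel[OF w])
  have int: "integrable lborel (H x)" for x
    unfolding H_def[abs_def] using hb by (intro integrable_mult_right) (auto simp: has_bochner_integral_iff)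
  have val: "(LINT s|lborel. H x s) = C * (F x * b x ^ k * E x)" for x
    unfolding H_def using hb[of x] by (simp add: has_bochner_integral_iff)
  have nval: "(LINT s|lborel. norm (H x s)) = norm (C * (F x * b x ^ k * E x))" for x
  proof -
    have "(LINT s|lborel. norm (H x s)) = (LINT s|lborel. \<bar>F x * b x ^ k\<bar> * (exp (t * s) * beam_kernel w0 lam (s - a x) (b x)))"
      by (rule Bochner_Integration.integral_cong) (simp_all add: H_def abs_mult beam_kernel_nonneg[OF w(1)])
    also have "\<dots> = \<bar>F x * b x ^ k\<bar> * (C * E x)"
      using hb[of x] by (simp add: has_bochner_integral_iff)
    also have "\<dots> = norm (C * (F x * b x ^ k * E x))"
      using w by (simp add: abs_mult C_def E_def)
    finally show ?thesis .
  qed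
  have cont: "continuous_on UNIV (\<lambda>x. C * (F x * b x ^ k * E x))"
    unfolding E_def by (intro continuous_intros F ab)
  have "integrable (lborel \<Otimes>\<^sub>M lborel) (\<lambda>(x, s). H x s)"
  proof (rule lborel_pair.Fubini_integrable)
    show "(\<lambda>(x, s). H x s) \<in> borel_measurable (lborel \<Otimes>\<^sub>M lborel)"
      unfolding H_def beam_kernel_def beam_width_def by measurable
    show "integrable lborel (\<lambda>x. LINT s|lborel. norm (case (x, s) of (x, s) \<Rightarrow> H x s))"
      unfolding prod.case nval using F(2)
      by (intro integrable_norm integrable_continuous_vanishing_outside_ball cont) auto
    show "AE x in lborel. integrable lborel (\<lambda>s. case (x, s) of (x, s) \<Rightarrow> H x s)"
      using int by simp
  qed
  then have "(LINT s|lborel. LINT x|lborel. H x s) = (LINT x|lborel. LINT s|lborel. H x s)"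
    by (rule lborel_pair.Fubini_integral)
  moreover have "(LINT x|lborel. H x s) = 0" for s
  proof -
    have "(LINT x|lborel. H x s) = (LINT x|lborel. exp (t * s) * (b x ^ k * beam_kernel w0 lam (s - a x) (b x) * F x))"
      by (rule Bochner_Integration.integral_cong) (simp_all add: H_def)
    then show ?thesis using data[of s] by simp
  qed
  ultimately have "C * (LINT x|lborel. F x * b x ^ k * E x) = 0"
    unfolding val by simp
  then show ?thesis using w by (simp add: C_def E_def)
qed

text \<open>
  Expanding \<open>exp (t y)\<close> and integrating term by term gives a power series in \<open>t\<close> that vanishes
  identically, so its coefficients are zero. The exchange is justified by
  \<open>exp \<bar>t y\<bar> \<le> exp (t y) + exp (- t y)\<close>, which is integrable against \<open>\<bar>\<phi>\<bar>\<close> because \<open>t\<close> ranges over both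
  signs.
\<close>

lemma moments_zero_if_laplace_zero:
  fixes \<phi> y :: "'a \<Rightarrow> real"
  assumes [measurable]: "\<phi> \<in> borel_measurable M" "y \<in> borel_measurable M"
    and int: "\<And>t. integrable M (\<lambda>x. \<phi> x * exp (t * y x))"
    and zero: "\<And>t. integral\<^sup>L M (\<lambda>x. \<phi> x * exp (t * y x)) = 0"
  shows "integrable M (\<lambda>x. \<phi> x * y x ^ d)" and "integral\<^sup>L M (\<lambda>x. \<phi> x * y x ^ d) = 0"
proof -
  have exp_bound: "\<bar>t * r\<bar> ^ n / fact n \<le> exp (t * r) + exp (- t * r)" for t r :: real and n
  proof -
    have "\<bar>t * r\<bar> ^ n / fact n \<le> exp \<bar>t * r\<bar>"
      using sum_le_suminf[OF summable_exp[of "\<bar>t * r\<bar>"], of "{n}"] 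
      by (simp add: exp_def divide_inverse mult_ac)
    also have "\<dots> \<le> exp (t * r) + exp (- t * r)"
      by (cases "t * r \<ge> 0") (auto simp: add_increasing add_increasing2)
    finally show ?thesis .
  qed
  have sum_bound: "(\<Sum>n<N. \<bar>t * r\<bar> ^ n / fact n) \<le> exp (t * r) + exp (- t * r)" for t r :: real and N
  proof -
    have "(\<Sum>n<N. \<bar>t * r\<bar> ^ n / fact n) \<le> exp \<bar>t * r\<bar>"
      using sum_le_suminf[OF summable_exp[of "\<bar>t * r\<bar>"], of "{..<N}"] 
      by (simp add: exp_def divide_inverse mult_ac)
    also have "\<dots> \<le> exp (t * r) + exp (- t * r)"
      by (cases "t * r \<ge> 0") (auto simp: add_increasing add_increasing2)
    finally show ?thesis .
  qed
  define G where "G t x = \<bar>\<phi> x\<bar> * (exp (t * y x) + exp (- t * y x))" for t x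
  have intG: "integrable M (G t)" for t
    using integrable_norm[OF int[of t]] integrable_norm[OF int[of "-t"]]
    unfolding G_def by (simp add: distrib_left abs_mult)
  have intn: "integrable M (\<lambda>x. \<phi> x * (t * y x) ^ n / fact n)" for t n
  proof (rule Bochner_Integration.integrable_bound[OF intG[of t]])
    show "AE x in M. norm (\<phi> x * (t * y x) ^ n / fact n) \<le> norm (G t x)"
    proof (rule AE_I2)
      fix x
      have "norm (\<phi> x * (t * y x) ^ n / fact n) = \<bar>\<phi> x\<bar> * (\<bar>t * y x\<bar> ^ n / fact n)"
        by (simp add: abs_mult power_abs)
      also have "\<dots> \<le> G t x"
        unfolding G_def by (intro mult_left_mono exp_bound) auto
      finally show "norm (\<phi> x * (t * y x) ^ n / fact n) \<le> norm (G t x)" by simp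
    qed
  qed measurable
  show "integrable M (\<lambda>x. \<phi> x * y x ^ d)"
    using integrable_mult_right[OF intn[of 1 d], of "fact d"] by simp
  define a where "a n = integral\<^sup>L M (\<lambda>x. \<phi> x * y x ^ n) / fact n" for n
  have a: "integral\<^sup>L M (\<lambda>x. \<phi> x * (t * y x) ^ n / fact n) = a n * t ^ n" for t n
    by (simp add: a_def power_mult_distrib mult.left_commute[of _ "t ^ n"] mult.commute)
  have sums: "(\<lambda>n. a n * t ^ n) sums 0" for t
  proof -
    have "(\<lambda>n. integral\<^sup>L M (\<lambda>x. \<phi> x * (t * y x) ^ n / fact n)) sums
        (integral\<^sup>L M (\<lambda>x. \<Sum>n. \<phi> x * (t * y x) ^ n / fact n))"
    proof (rule sums_integral)
      show "AE x in M. summable (\<lambda>n. norm (\<phi> x * (t * y x) ^ n / fact n))"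
      proof (rule AE_I2)
        fix x
        show "summable (\<lambda>n. norm (\<phi> x * (t * y x) ^ n / fact n))"
          using summable_mult[OF summable_exp[of "\<bar>t * y x\<bar>"], of "\<bar>\<phi> x\<bar>"]
          by (simp add: abs_mult power_abs divide_inverse mult_ac)
      qed
      show "summable (\<lambda>n. LINT x|M. norm (\<phi> x * (t * y x) ^ n / fact n))"
      proof (rule bounded_imp_summable[where B = "integral\<^sup>L M (G t)"])
        fix N
        have "(\<Sum>n\<le>N. LINT x|M. norm (\<phi> x * (t * y x) ^ n / fact n)) =
            (LINT x|M. (\<Sum>n<Suc N. norm (\<phi> x * (t * y x) ^ n / fact n)))"
          unfolding lessThan_Suc_atMost
          by (rule Bochner_Integration.integral_sum[symmetric]) (rule integrable_norm[OF intn])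
        also have "\<dots> \<le> integral\<^sup>L M (G t)"
        proof (rule integral_mono)
          show "integrable M (\<lambda>x. \<Sum>n<Suc N. norm (\<phi> x * (t * y x) ^ n / fact n))"
            by (rule Bochner_Integration.integrable_sum) (rule integrable_norm[OF intn])
          fix x
          have "(\<Sum>n<Suc N. norm (\<phi> x * (t * y x) ^ n / fact n)) = \<bar>\<phi> x\<bar> * (\<Sum>n<Suc N. \<bar>t * y x\<bar> ^ n / fact n)"
            unfolding sum_distrib_left by (rule sum.cong) (simp_all add: abs_mult power_abs)
          also have "\<dots> \<le> G t x"
            unfolding G_def by (intro mult_left_mono sum_bound) auto
          finally show "(\<Sum>n<Suc N. norm (\<phi> x * (t * y x) ^ n / fact n)) \<le> G t x" .
        qed (rule intG)
        finally show "(\<Sum>n\<le>N. LINT x|M. norm (\<phi> x * (t * y x) ^ n / fact n)) \<le> integral\<^sup>L M (G t)" .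
      qed simp
    qed (rule intn)
    moreover have "(\<lambda>x. \<Sum>n. \<phi> x * (t * y x) ^ n / fact n) = (\<lambda>x. \<phi> x * exp (t * y x))"
    proof
      fix x
      show "(\<Sum>n. \<phi> x * (t * y x) ^ n / fact n) = \<phi> x * exp (t * y x)"
        using sums_unique[OF sums_mult[OF exp_converges[of "t * y x"], of "\<phi> x"]]
        by (simp add: divide_inverse mult_ac)
    qed
    ultimately show ?thesis by (simp only: a zero)
  qed
  have "a d = 0"
  proof (rule ccontr)
    assume "a d \<noteq> 0"
    define m where "m = (LEAST n. a n \<noteq> 0)"
    have m: "a m \<noteq> 0" unfolding m_def by (rule LeastI) fact
    have lt: "a n = 0" if "n < m" for n using not_less_Least[of n] that unfolding m_def by blast
    have "((\<lambda>x. 0) \<longlongrightarrow> a (0 + m)) (at (0::real))"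
    proof (rule powser_limit_0_strong[where s = 1 and a = "\<lambda>n. a (n + m)"])
      fix x :: real assume "x \<noteq> 0"
      have "(\<lambda>n. a (n + m) * x ^ (n + m)) sums (0 - (\<Sum>n<m. a n * x ^ n))"
        using sums[of x] by (rule sums_split_initial_segment)
      then have "(\<lambda>n. a (n + m) * x ^ (n + m)) sums 0" by (simp add: lt)
      from sums_mult[OF this, of "inverse (x ^ m)"]
      have "(\<lambda>n. inverse (x ^ m) * (a (n + m) * x ^ (n + m))) sums 0" by simp
      moreover have "inverse (x ^ m) * (a (n + m) * x ^ (n + m)) = a (n + m) * x ^ n" for n
        using \<open>x \<noteq> 0\<close> by (simp add: power_add)
      ultimately show "(\<lambda>n. a (n + m) * x ^ n) sums 0" by simp
    qed simp
    then have "a m = 0" by (simp add: tendsto_const_iff)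
    with m show False by simp
  qed
  then show "integral\<^sup>L M (\<lambda>x. \<phi> x * y x ^ d) = 0" by (simp add: a_def)
qed

text \<open>
  The factor \<open>exp (c t\<^sup>2 b\<^sup>2)\<close> is a Gaussian average of \<open>exp (t y b)\<close>, and weighting this average with
  \<open>y\<close> or \<open>y\<^sup>2\<close> produces a linear combination of \<open>1\<close>, \<open>b\<close> and \<open>b\<^sup>2\<close> times the same factor. The three data
  sets are exactly what is needed for the weights \<open>1, y, y\<^sup>2\<close>.
\<close>

lemma gaussian_averaged_moments_zero:
  fixes F a b :: "'a::euclidean_space \<Rightarrow> real"
  assumes c: "c > 0"
    and F: "continuous_on UNIV F" "\<And>x. norm x \<ge> 1 \<Longrightarrow> F x = 0"
    and ab: "continuous_on UNIV a" "continuous_on UNIV b"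
    and data: "\<And>t k. k \<in> {0, 1, 2} \<Longrightarrow> (LINT x|lborel. F x * b x ^ k * exp (t * a x + c * t\<^sup>2 * (b x)\<^sup>2)) = 0"
    and k: "k \<in> {0, 1, 2}"
  shows "(LINT x|lborel. F x * (LINT y|lborel. y ^ k * gauss_weight c y * (a x + y * b x) ^ d)) = 0"
proof -
  have [measurable]: "F \<in> borel_measurable borel" "a \<in> borel_measurable borel" "b \<in> borel_measurable borel"
    using F ab by (auto intro: borel_measurable_continuous_onI)
  let ?M = "lborel \<Otimes>\<^sub>M lborel :: ('a \<times> real) measure"
  define H where "H k t x y = F x * exp (t * a x) * (y ^ k * gauss_weight c y * exp (t * b x * y))" for k t x and y :: real
  have H: "integrable lborel (H k t x)" "(LINT y|lborel. H k t x y) = F x * exp (t * a x) * gauss_exp_moment c k (t * b x)"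
    if "k \<in> {0, 1, 2}" for k t x
    using has_integral_gauss_exp_moment[OF c that, of "t * b x"] unfolding H_def[abs_def] by (auto simp: has_bochner_integral_iff)
  have Habs: "\<bar>H k t x y\<bar> = (if F x \<ge> 0 then H k t x y else - H k t x y)" if "k = 0 \<or> k = 2" for k t x y
    using that by (auto simp: H_def abs_mult)
  have intHabs: "integrable ?M (\<lambda>(x, y). H k t x y)" if "k = 0 \<or> k = 2" for k t
  proof (rule lborel_pair.Fubini_integrable)
    have k: "k \<in> {0, 1, 2}" using that by auto
    show "(\<lambda>(x, y). H k t x y) \<in> borel_measurable ?M"
      unfolding H_def by measurable
    have "(\<lambda>x. LINT y|lborel. norm (H k t x y)) = (\<lambda>x. norm (F x * exp (t * a x) * gauss_exp_moment c k (t * b x)))"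
    proof
      fix x
      show "(LINT y|lborel. norm (H k t x y)) = norm (F x * exp (t * a x) * gauss_exp_moment c k (t * b x))"
      proof (cases "F x \<ge> 0")
        case True
        then have "(LINT y|lborel. norm (H k t x y)) = (LINT y|lborel. H k t x y)"
          by (simp add: Habs[OF that])
        moreover have "(LINT y|lborel. norm (H k t x y)) \<ge> 0" by simp
        ultimately show ?thesis unfolding H(2)[OF k] by simp
      next
        case False
        then have "(LINT y|lborel. norm (H k t x y)) = - (LINT y|lborel. H k t x y)"
          by (simp add: Habs[OF that])
        moreover have "(LINT y|lborel. norm (H k t x y)) \<ge> 0" by simp
        ultimately show ?thesis unfolding H(2)[OF k] by simp
      qed
    qed
    moreover have "integrable lborel (\<lambda>x. norm (F x * exp (t * a x) * gauss_exp_moment c k (t * b x)))"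
    proof (intro integrable_norm integrable_continuous_vanishing_outside_ball)
      show "continuous_on UNIV (\<lambda>x. F x * exp (t * a x) * gauss_exp_moment c k (t * b x))"
        using that unfolding gauss_exp_moment_def by (auto intro!: continuous_intros F ab)
    qed (use F in auto)
    ultimately show "integrable lborel (\<lambda>x. LINT y|lborel. norm (case (x, y) of (x, y) \<Rightarrow> H k t x y))"
      by simp
    show "AE x in lborel. integrable lborel (\<lambda>y. case (x, y) of (x, y) \<Rightarrow> H k t x y)"
      using H(1)[OF k] by simp
  qed
  have intH: "integrable ?M (\<lambda>(x, y). H k t x y)" if "k \<in> {0, 1, 2}" for k t
  proof (rule Bochner_Integration.integrable_bound)
    show "integrable ?M (\<lambda>p. norm ((\<lambda>(x, y). H 0 t x y) p) + norm ((\<lambda>(x, y). H 2 t x y) p))"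
      by (intro Bochner_Integration.integrable_add integrable_norm intHabs) auto
    show "(\<lambda>(x, y). H k t x y) \<in> borel_measurable ?M"
      unfolding H_def by measurable
    have "\<bar>y ^ k\<bar> \<le> 1 + y\<^sup>2" for y :: real
    proof -
      have "2 * \<bar>y\<bar> \<le> 1 + y\<^sup>2" using zero_le_power2[of "\<bar>y\<bar> - 1"] by (simp add: power2_diff)
      then have "\<bar>y\<bar> \<le> 1 + y\<^sup>2" using abs_ge_zero[of y] by linarith
      then show ?thesis using that by auto
    qed
    then have "\<bar>H k t x y\<bar> \<le> \<bar>F x * exp (t * a x)\<bar> * ((1 + y\<^sup>2) * gauss_weight c y * exp (t * b x * y))" for x y
      unfolding H_def abs_mult by (intro mult_left_mono mult_right_mono) auto
    also have "\<dots> x y = \<bar>H 0 t x y\<bar> + \<bar>H 2 t x y\<bar>" for x y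
      by (simp add: H_def abs_mult algebra_simps)
    finally show "AE p in ?M. norm ((\<lambda>(x, y). H k t x y) p) \<le>
        norm (norm ((\<lambda>(x, y). H 0 t x y) p) + norm ((\<lambda>(x, y). H 2 t x y) p))"
      by (intro AE_I2) auto
  qed
  have zeroH: "integral\<^sup>L ?M (\<lambda>(x, y). H k t x y) = 0" if "k \<in> {0, 1, 2}" for k t
  proof -
    \<comment> \<open>The integrals over \<open>y\<close> are explicit, and what remains over \<open>x\<close> is a combination of the given data.\<close>
    define D where "D k x = F x * b x ^ k * exp (t * a x + c * t\<^sup>2 * (b x)\<^sup>2)" for k x
    have intD: "integrable lborel (D k)" for k
      unfolding D_def[abs_def]
      by (rule integrable_continuous_vanishing_outside_ball) (auto intro!: continuous_intros F ab)
    have D0: "(LINT x|lborel. D k x) = 0" if "k \<in> {0, 1, 2}" for k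
      unfolding D_def using data[OF that] .
    have "integral\<^sup>L ?M (\<lambda>(x, y). H k t x y) = (LINT x|lborel. LINT y|lborel. H k t x y)"
      using lborel_pair.integral_fst'[OF intH[OF that]] by simp
    also have "\<dots> = (LINT x|lborel. sqrt (4 * pi * c) * (if k = 0 then D 0 x else if k = 1 then 2 * c * t * D 1 x
        else 2 * c * D 0 x + 4 * c\<^sup>2 * t\<^sup>2 * D 2 x))"
      unfolding H(2)[OF that]
      by (rule Bochner_Integration.integral_cong)
        (auto simp: D_def gauss_exp_moment_def exp_add power_mult_distrib algebra_simps)
    also have "\<dots> = 0"
    proof -
      have "k = 0 \<or> k = 1 \<or> k = 2" using that by auto
      then show ?thesis
        using D0[of 0] D0[of 1] D0[of 2] intD by (elim disjE) simp_all
    qed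
    finally show ?thesis .
  qed
  let ?\<phi> = "\<lambda>(x, y). F x * (y ^ k * gauss_weight c y)" and ?y = "\<lambda>(x, y). a x + y * b x"
  have eqH: "?\<phi> p * exp (t * ?y p) = (\<lambda>(x, y). H k t x y) p" for t p
    by (auto simp: H_def exp_add[symmetric] algebra_simps split: prod.split)
  have meas: "?\<phi> \<in> borel_measurable ?M" "?y \<in> borel_measurable ?M"
    by measurable
  have m: "integrable ?M (\<lambda>p. ?\<phi> p * ?y p ^ d)" "integral\<^sup>L ?M (\<lambda>p. ?\<phi> p * ?y p ^ d) = 0"
    using moments_zero_if_laplace_zero[OF meas, of d] intH[OF k] zeroH[OF k] unfolding eqH by blast+
  have "(LINT x|lborel. LINT y|lborel. ?\<phi> (x, y) * ?y (x, y) ^ d) = 0"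
    using lborel_pair.integral_fst'[OF m(1)] m(2) by simp
  then show ?thesis
    by (simp add: mult.assoc)
qed

section \<open>Nondegeneracy of a complex Gaussian weight\<close>

text \<open>
  The real part is an even polynomial in \<open>y\<close> with value \<open>1\<close> at the origin; its leading coefficient
  decides the sign.
\<close>

lemma Re_power_eventually_signed:
  "\<exists>\<eta> R. (\<eta> = 1 \<or> \<eta> = -1) \<and> R \<ge> 1 \<and> (\<forall>y::real. \<bar>y\<bar> \<ge> R \<longrightarrow> \<eta> * Re ((1 + \<i> * of_real y) ^ j) > 0)"
proof -
  have "\<exists>U V :: real poly. \<forall>y. (1 + \<i> * of_real y) ^ j = Complex (poly U y) (poly V y)"
  proof (induction j)
    case 0
    show ?case by (rule exI[of _ 1], rule exI[of _ 0]) (simp add: complex_eq_iff)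
  next
    case (Suc j)
    then obtain U V :: "real poly" where UV: "\<And>y. (1 + \<i> * of_real y) ^ j = Complex (poly U y) (poly V y)" by blast
    show ?case
      by (rule exI[of _ "U - [:0, 1:] * V"], rule exI[of _ "V + [:0, 1:] * U"]) (simp add: UV complex_eq_iff)
  qed
  then obtain U V :: "real poly" where UV: "\<And>y. (1 + \<i> * of_real y) ^ j = Complex (poly U y) (poly V y)" by blast
  have U: "Re ((1 + \<i> * of_real y) ^ j) = poly U y" for y by (simp add: UV)
  have "poly U 0 = 1" using UV[of 0] by (simp add: complex_eq_iff)
  then have "U \<noteq> 0" by auto
  then have "lead_coeff U < 0 \<or> lead_coeff U > 0"
    by (simp add: neq_iff[symmetric])
  define \<eta> where "\<eta> = sgn (lead_coeff U)"
  have \<eta>: "\<eta> = 1 \<or> \<eta> = -1"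
    using \<open>lead_coeff U < 0 \<or> lead_coeff U > 0\<close> by (auto simp: \<eta>_def)
  have "lead_coeff (smult \<eta> U) > 0"
    using \<open>lead_coeff U < 0 \<or> lead_coeff U > 0\<close> by (auto simp: \<eta>_def)
  then obtain n where n: "\<And>x. x \<ge> n \<Longrightarrow> poly (smult \<eta> U) x \<ge> lead_coeff (smult \<eta> U)"
    using poly_pinfty_gt_lc by blast
  have pos: "\<eta> * poly U x > 0" if "x \<ge> n" for x
    using n[OF that] \<open>lead_coeff (smult \<eta> U) > 0\<close> by simp
  have even: "poly U (- x) = poly U x" for x
  proof -
    have "1 + \<i> * of_real (- x) = cnj (1 + \<i> * of_real x)" by simp
    then have "poly U (- x) = Re (cnj ((1 + \<i> * of_real x) ^ j))"
      unfolding U[symmetric] by (simp only: complex_cnj_power)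
    then show ?thesis by (simp only: cnj.sel U)
  qed
  have "\<eta> * poly U y > 0" if "\<bar>y\<bar> \<ge> max 1 n" for y
    using pos[of y] pos[of "- y"] that by (cases "y \<ge> 0") (auto simp: even)
  then show ?thesis
    using \<eta> by (intro exI[of _ \<eta>] exI[of _ "max 1 n"]) (auto simp: U)
qed

text \<open>
  The weight \<open>v\<close> may be negative inside \<open>[-R, R]\<close>, but there \<open>(1 + y\<^sup>2)\<^sup>n\<close> is smaller than on \<open>\<bar>y\<bar> \<ge> R + 1\<close> by
  a factor that is exponentially small in \<open>n\<close>. A nonnegative \<open>q\<close> whose values near the origin are
  controlled by its values at points of three outer shells therefore has a positive integral, with a
  threshold for \<open>n\<close> that does not depend on \<open>q\<close>. Three shells suit quadratic polynomials, which are
  determined by three values.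
\<close>

lemma far_shells_dominate:
  fixes v :: "real \<Rightarrow> real"
  assumes v: "continuous_on UNIV v" and R: "R \<ge> 0" and pos: "\<And>y. \<bar>y\<bar> \<ge> R \<Longrightarrow> v y > 0" and C: "C \<ge> 0"
  shows "\<exists>N. \<forall>n\<ge>N. \<forall>q.
     (\<forall>y. q y \<ge> 0) \<longrightarrow> continuous_on UNIV q \<longrightarrow> integrable lborel (\<lambda>y. v y * (1 + y\<^sup>2) ^ n * q y) \<longrightarrow>
     (\<forall>y x\<^sub>1 x\<^sub>2 x\<^sub>3. \<bar>y\<bar> \<le> R \<longrightarrow> x\<^sub>1 \<in> {R+1..R+2} \<longrightarrow> x\<^sub>2 \<in> {R+3..R+4} \<longrightarrow> x\<^sub>3 \<in> {R+5..R+6} \<longrightarrow>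
        q y \<le> C * (q x\<^sub>1 + q x\<^sub>2 + q x\<^sub>3)) \<longrightarrow>
     (\<exists>y. \<bar>y\<bar> \<le> R \<and> q y > 0) \<longrightarrow>
     (LINT y|lborel. v y * (1 + y\<^sup>2) ^ n * q y) > 0"
proof -
  have cont: "continuous_on S v" for S using v by (rule continuous_on_subset) auto
  obtain x0 where x0: "x0 \<in> {R+1..R+6}" "\<And>x. x \<in> {R+1..R+6} \<Longrightarrow> v x0 \<le> v x"
    using continuous_attains_inf[of "{R+1..R+6}" v] cont by auto
  define \<kappa> where "\<kappa> = v x0"
  have \<kappa>: "\<kappa> > 0" using x0(1) R by (auto simp: \<kappa>_def intro!: pos)
  obtain x1 where x1: "x1 \<in> {-R..R}" "\<And>x. x \<in> {-R..R} \<Longrightarrow> \<bar>v x\<bar> \<le> \<bar>v x1\<bar>"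
    using continuous_attains_sup[of "{-R..R}" "\<lambda>x. \<bar>v x\<bar>"] continuous_on_rabs[OF cont] R by auto
  define V where "V = \<bar>v x1\<bar>"
  define L where "L = (1 + (R+1)\<^sup>2) / (1 + R\<^sup>2)"
  have R2: "1 + R\<^sup>2 > 0" "1 + (R+1)\<^sup>2 > 0" by (simp_all add: add_pos_nonneg)
  have "L > 1" using R R2 by (simp add: L_def power2_eq_square algebra_simps)
  then obtain N where N: "V * C * (2 * R) / \<kappa> < L ^ N" using real_arch_pow by blast
  show ?thesis
  proof (intro exI[of _ N] allI impI)
    fix n q
    assume n: "n \<ge> N" and q0: "\<forall>y. q y \<ge> 0" and qc: "continuous_on UNIV q"
      and int: "integrable lborel (\<lambda>y. v y * (1 + y\<^sup>2) ^ n * q y)"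
      and qb: "\<forall>y x\<^sub>1 x\<^sub>2 x\<^sub>3. \<bar>y\<bar> \<le> R \<longrightarrow> x\<^sub>1 \<in> {R+1..R+2} \<longrightarrow> x\<^sub>2 \<in> {R+3..R+4} \<longrightarrow> x\<^sub>3 \<in> {R+5..R+6} \<longrightarrow>
        q y \<le> C * (q x\<^sub>1 + q x\<^sub>2 + q x\<^sub>3)"
      and ex: "\<exists>y. \<bar>y\<bar> \<le> R \<and> q y > 0"
    have qc': "continuous_on S q" for S using qc by (rule continuous_on_subset) auto
    have min: "\<exists>x\<in>{a..a+1}. \<forall>y\<in>{a..a+1}. q x \<le> q y" for a :: real
      using continuous_attains_inf[of "{a..a+1}" q] qc' by auto
    obtain z1 where z1: "z1 \<in> {R+1..R+2}" "\<And>y. y \<in> {R+1..R+2} \<Longrightarrow> q z1 \<le> q y"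
      using min[of "R+1"] by (auto simp: add.assoc)
    obtain z2 where z2: "z2 \<in> {R+3..R+4}" "\<And>y. y \<in> {R+3..R+4} \<Longrightarrow> q z2 \<le> q y"
      using min[of "R+3"] by (auto simp: add.assoc)
    obtain z3 where z3: "z3 \<in> {R+5..R+6}" "\<And>y. y \<in> {R+5..R+6} \<Longrightarrow> q z3 \<le> q y"
      using min[of "R+5"] by (auto simp: add.assoc)
    \<comment> \<open>The minima over the three shells bound \<open>q\<close> from above near the origin and from below on the shells;
      both sides of the comparison thus scale with the same number \<open>m\<close>.\<close>
    define m where "m = q z1 + q z2 + q z3"
    have qm: "q y \<le> C * m" if "\<bar>y\<bar> \<le> R" for y
      using qb that z1(1) z2(1) z3(1) unfolding m_def by blast
    have "m > 0"
    proof -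
      obtain y where "\<bar>y\<bar> \<le> R" "q y > 0" using ex by blast
      then have "C * m > 0" using qm[of y] by linarith
      with C show ?thesis by (simp add: zero_less_mult_iff)
    qed
    define A B where "A = (1 + R\<^sup>2) ^ n * V * (C * m)" and "B = (1 + (R+1)\<^sup>2) ^ n * \<kappa>"
    have "B > 0" unfolding B_def using R2 \<kappa> by simp
    \<comment> \<open>A step function below the integrand. Its integral is \<open>m\<close> times a difference that is positive for
      \<open>n \<ge> N\<close>.\<close>
    define l where "l y = - A * indicator {-R..R} y
        + B * (q z1 * indicator {R+1..R+2} y + q z2 * indicator {R+3..R+4} y + q z3 * indicator {R+5..R+6} y)" for y :: real
    have far: "B * m' \<le> v y * (1 + y\<^sup>2) ^ n * q y" if "y \<in> {R+1..R+6}" "0 \<le> m'" "m' \<le> q y" for y m'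
    proof -
      have "R + 1 \<le> y" using that by simp
      then have "(1 + (R+1)\<^sup>2) ^ n \<le> (1 + y\<^sup>2) ^ n" using R by (intro power_mono add_left_mono) auto
      then have "(1 + (R+1)\<^sup>2) ^ n * \<kappa> * m' \<le> (1 + y\<^sup>2) ^ n * v y * q y"
        using x0(2)[OF that(1)] \<kappa> that R2 unfolding \<kappa>_def[symmetric]
        by (intro mult_mono) auto
      then show ?thesis by (simp add: B_def mult_ac)
    qed
    have le: "l y \<le> v y * (1 + y\<^sup>2) ^ n * q y" for y
    proof (cases "\<bar>y\<bar> \<le> R")
      case True
      have "y\<^sup>2 \<le> R\<^sup>2" using True by (simp add: abs_le_square_iff[symmetric])
      then have "(1 + y\<^sup>2) ^ n \<le> (1 + R\<^sup>2) ^ n" by (intro power_mono) auto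
      moreover have "\<bar>v y\<bar> \<le> V" unfolding V_def by (rule x1(2)) (use True in auto)
      ultimately have "(1 + y\<^sup>2) ^ n * \<bar>v y\<bar> * q y \<le> A"
        unfolding A_def using qm[OF True] q0 R2 by (intro mult_mono) (auto simp: V_def)
      moreover have "\<bar>v y * (1 + y\<^sup>2) ^ n * q y\<bar> = (1 + y\<^sup>2) ^ n * \<bar>v y\<bar> * q y"
        using q0 by (simp add: abs_mult mult_ac)
      ultimately have "- A \<le> v y * (1 + y\<^sup>2) ^ n * q y" by linarith
      moreover have "l y = - A" using True R by (auto simp: l_def indicator_def)
      ultimately show ?thesis by simp
    next
      case False
      have nn: "0 \<le> v y * (1 + y\<^sup>2) ^ n * q y"
        using pos[of y] False q0 by (intro mult_nonneg_nonneg) auto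
      consider "y \<in> {R+1..R+2}" | "y \<in> {R+3..R+4}" | "y \<in> {R+5..R+6}"
        | "y \<notin> {R+1..R+2}" "y \<notin> {R+3..R+4}" "y \<notin> {R+5..R+6}" by blast
      then show ?thesis
      proof cases
        case 1
        then have "l y = B * q z1" using False by (auto simp: l_def indicator_def)
        then show ?thesis using far[of y "q z1"] z1(2)[OF 1] q0 1 by auto
      next
        case 2
        then have "l y = B * q z2" using False by (auto simp: l_def indicator_def)
        then show ?thesis using far[of y "q z2"] z2(2)[OF 2] q0 2 by auto
      next
        case 3
        then have "l y = B * q z3" using False by (auto simp: l_def indicator_def)
        then show ?thesis using far[of y "q z3"] z3(2)[OF 3] q0 3 by auto
      next
        case 4
        then have "l y = 0" using False by (auto simp: l_def indicator_def)
        then show ?thesis using nn by simp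
      qed
    qed
    have hl: "has_bochner_integral lborel l (- A * (2 * R) + B * (q z1 * 1 + q z2 * 1 + q z3 * 1))"
    proof -
      have ind: "has_bochner_integral lborel (indicator {a..b} :: real \<Rightarrow> real) (b - a)" if "a \<le> b" for a b :: real
        using has_bochner_integral_real_indicator[of "{a..b}" lborel] that by simp
      show ?thesis unfolding l_def[abs_def]
        using R ind[of "-R" R] ind[of "R+1" "R+2"] ind[of "R+3" "R+4"] ind[of "R+5" "R+6"]
        by (intro has_bochner_integral_add has_bochner_integral_mult_right) auto
    qed
    have "V * C * (2 * R) < \<kappa> * L ^ n"
    proof -
      have "L ^ N \<le> L ^ n" using n \<open>L > 1\<close> by (intro power_increasing) auto
      then have "V * C * (2 * R) / \<kappa> < L ^ n" using N by linarith
      then show ?thesis using \<kappa> by (simp add: field_simps)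
    qed
    then have "(1 + R\<^sup>2) ^ n * (V * C * (2 * R)) < (1 + R\<^sup>2) ^ n * (\<kappa> * L ^ n)"
      using R2 by simp
    also have "\<dots> = B" using R2 by (simp add: B_def L_def power_divide)
    finally have "m * ((1 + R\<^sup>2) ^ n * (V * C * (2 * R))) < m * B" using \<open>m > 0\<close> by simp
    then have "0 < - A * (2 * R) + B * (q z1 * 1 + q z2 * 1 + q z3 * 1)"
      unfolding A_def by (simp add: m_def mult_ac)
    also have "\<dots> = integral\<^sup>L lborel l" using hl by (simp add: has_bochner_integral_iff)
    also have "\<dots> \<le> (LINT y|lborel. v y * (1 + y\<^sup>2) ^ n * q y)"
      using hl int le by (intro integral_mono) (auto simp: has_bochner_integral_iff)
    finally show "(LINT y|lborel. v y * (1 + y\<^sup>2) ^ n * q y) > 0" .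
  qed
qed

text \<open>
  Lagrange interpolation at three nodes whose mutual distances are at least one.
\<close>

lemma quadratic_interpolation_bound:
  fixes p\<^sub>0 p\<^sub>1 p\<^sub>2 :: complex and R y x\<^sub>1 x\<^sub>2 x\<^sub>3 :: real
  defines "P \<equiv> \<lambda>y. p\<^sub>0 + p\<^sub>1 * of_real y + p\<^sub>2 * (of_real y)\<^sup>2"
  assumes "\<bar>y\<bar> \<le> R" "x\<^sub>1 \<in> {R+1..R+2}" "x\<^sub>2 \<in> {R+3..R+4}" "x\<^sub>3 \<in> {R+5..R+6}"
  shows "(cmod (P y))\<^sup>2 \<le> 3 * ((2*R+6)^3)\<^sup>2 * ((cmod (P x\<^sub>1))\<^sup>2 + (cmod (P x\<^sub>2))\<^sup>2 + (cmod (P x\<^sub>3))\<^sup>2)"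
proof -
  define M where "M = 2 * R + 6"
  define a b c where "a = (y - x\<^sub>2) * (y - x\<^sub>3) * (x\<^sub>2 - x\<^sub>3)" and "b = (y - x\<^sub>1) * (y - x\<^sub>3) * (x\<^sub>1 - x\<^sub>3)"
    and "c = (y - x\<^sub>1) * (y - x\<^sub>2) * (x\<^sub>1 - x\<^sub>2)"
  define d where "d = (x\<^sub>1 - x\<^sub>2) * (x\<^sub>1 - x\<^sub>3) * (x\<^sub>2 - x\<^sub>3)"
  have id: "of_real d * P y = of_real a * P x\<^sub>1 - of_real b * P x\<^sub>2 + of_real c * P x\<^sub>3"
    unfolding P_def a_def b_def c_def d_def by (simp add: algebra_simps power2_eq_square)
  have R: "R \<ge> 0" using assms(2) by linarith
  have bnd: "\<bar>u\<bar> * \<bar>v\<bar> * \<bar>w\<bar> \<le> M ^ 3" if "\<bar>u\<bar> \<le> M" "\<bar>v\<bar> \<le> M" "\<bar>w\<bar> \<le> M" for u v w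
    using that by (auto simp: power3_eq_cube intro!: mult_mono)
  have abc: "\<bar>a\<bar> \<le> M ^ 3" "\<bar>b\<bar> \<le> M ^ 3" "\<bar>c\<bar> \<le> M ^ 3"
    unfolding a_def b_def c_def abs_mult using assms R
    by (intro bnd; simp add: M_def abs_le_iff)+
  have "1 * 1 * 1 \<le> \<bar>x\<^sub>1 - x\<^sub>2\<bar> * \<bar>x\<^sub>1 - x\<^sub>3\<bar> * \<bar>x\<^sub>2 - x\<^sub>3\<bar>"
    using assms by (intro mult_mono) auto
  then have "1 \<le> \<bar>d\<bar>" unfolding d_def abs_mult by simp
  then have "cmod (P y) \<le> \<bar>d\<bar> * cmod (P y)" using mult_right_mono[of 1 "\<bar>d\<bar>" "cmod (P y)"] by simp
  also have "\<dots> = cmod (of_real a * P x\<^sub>1 - of_real b * P x\<^sub>2 + of_real c * P x\<^sub>3)"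
    unfolding id[symmetric] by (simp add: norm_mult)
  also have "\<dots> \<le> cmod (of_real a * P x\<^sub>1) + cmod (of_real b * P x\<^sub>2) + cmod (of_real c * P x\<^sub>3)"
    by (rule norm_triangle_le) (simp add: norm_triangle_ineq4)
  also have "\<dots> \<le> M ^ 3 * cmod (P x\<^sub>1) + M ^ 3 * cmod (P x\<^sub>2) + M ^ 3 * cmod (P x\<^sub>3)"
    unfolding norm_mult norm_of_real using abc by (intro add_mono mult_right_mono) auto
  finally have "cmod (P y) \<le> M ^ 3 * (cmod (P x\<^sub>1) + cmod (P x\<^sub>2) + cmod (P x\<^sub>3))"
    by (simp add: distrib_left)
  then have "(cmod (P y))\<^sup>2 \<le> (M ^ 3 * (cmod (P x\<^sub>1) + cmod (P x\<^sub>2) + cmod (P x\<^sub>3)))\<^sup>2"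
    by (rule power_mono) simp
  also have "\<dots> = (M ^ 3)\<^sup>2 * (cmod (P x\<^sub>1) + cmod (P x\<^sub>2) + cmod (P x\<^sub>3))\<^sup>2"
    by (simp add: power_mult_distrib)
  also have "\<dots> \<le> (M ^ 3)\<^sup>2 * (3 * ((cmod (P x\<^sub>1))\<^sup>2 + (cmod (P x\<^sub>2))\<^sup>2 + (cmod (P x\<^sub>3))\<^sup>2))"
  proof (rule mult_left_mono)
    have "(s + t + u)\<^sup>2 \<le> 3 * (s\<^sup>2 + t\<^sup>2 + u\<^sup>2)" for s t u :: real
      using zero_le_power2[of "s - t"] zero_le_power2[of "s - u"] zero_le_power2[of "t - u"]
      by (simp add: power2_eq_square algebra_simps)
    then show "(cmod (P x\<^sub>1) + cmod (P x\<^sub>2) + cmod (P x\<^sub>3))\<^sup>2 \<le> 3 * ((cmod (P x\<^sub>1))\<^sup>2 + (cmod (P x\<^sub>2))\<^sup>2 + (cmod (P x\<^sub>3))\<^sup>2)" .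
  qed simp
  finally show ?thesis by (simp only: M_def mult_ac)
qed

text \<open>
  Combining the three relations with the conjugate coefficients of \<open>P\<close> shows that the weight integrates
  to zero against \<open>\<bar>P\<bar>\<^sup>2\<close>. For large \<open>n\<close> the real part of this integral has the sign of the real part of
  \<open>(1 + \<i> y)\<^sup>j\<close> far from the origin, unless \<open>P\<close> vanishes.
\<close>

lemma gaussian_quadratic_orthogonality:
  assumes c: "c > 0"
  shows "\<exists>N. \<forall>n\<ge>N. \<forall>p\<^sub>0 p\<^sub>1 p\<^sub>2 :: complex.
    (\<forall>k\<in>{0, 1, 2}. (LINT y|lborel. gauss_weight c y *\<^sub>R
        (of_real y ^ k * ((1 + (of_real y)\<^sup>2) ^ n * (1 + \<i> * of_real y) ^ j * (p\<^sub>0 + p\<^sub>1 * of_real y + p\<^sub>2 * (of_real y)\<^sup>2)))) = 0)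
    \<longrightarrow> p\<^sub>0 = 0 \<and> p\<^sub>1 = 0 \<and> p\<^sub>2 = 0"
proof -
  obtain \<eta> R where \<eta>: "\<eta> = 1 \<or> \<eta> = -1" and R: "R \<ge> 1"
    and signed: "\<And>y::real. \<bar>y\<bar> \<ge> R \<Longrightarrow> \<eta> * Re ((1 + \<i> * of_real y) ^ j) > 0"
    using Re_power_eventually_signed by blast
  define v where "v y = gauss_weight c y * (\<eta> * Re ((1 + \<i> * of_real y) ^ j))" for y
  define C where "C = 3 * ((2*R+6)^3)\<^sup>2"
  have "continuous_on UNIV v" unfolding v_def[abs_def] by (intro continuous_intros c)
  moreover have "v y > 0" if "\<bar>y\<bar> \<ge> R" for y
    unfolding v_def by (intro mult_pos_pos signed that) simp
  moreover have "R \<ge> 0" "C \<ge> 0" using R by (auto simp: C_def)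
  ultimately obtain N where N: "\<And>n q. n \<ge> N \<Longrightarrow>
     (\<forall>y. q y \<ge> 0) \<Longrightarrow> continuous_on UNIV q \<Longrightarrow> integrable lborel (\<lambda>y. v y * (1 + y\<^sup>2) ^ n * q y) \<Longrightarrow>
     (\<forall>y x\<^sub>1 x\<^sub>2 x\<^sub>3. \<bar>y\<bar> \<le> R \<longrightarrow> x\<^sub>1 \<in> {R+1..R+2} \<longrightarrow> x\<^sub>2 \<in> {R+3..R+4} \<longrightarrow> x\<^sub>3 \<in> {R+5..R+6} \<longrightarrow>
        q y \<le> C * (q x\<^sub>1 + q x\<^sub>2 + q x\<^sub>3)) \<Longrightarrow>
     (\<exists>y. \<bar>y\<bar> \<le> R \<and> q y > 0) \<Longrightarrow>
     (LINT y|lborel. v y * (1 + y\<^sup>2) ^ n * q y) > 0"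
    using far_shells_dominate[of v R C] by blast
  show ?thesis
  proof (intro exI[of _ N] allI impI)
    fix n and p\<^sub>0 p\<^sub>1 p\<^sub>2 :: complex
    define P where "P y = p\<^sub>0 + p\<^sub>1 * of_real y + p\<^sub>2 * (of_real y)\<^sup>2" for y :: real
    define w where "w y = (1 + (of_real y)\<^sup>2) ^ n * (1 + \<i> * of_real y) ^ j" for y :: real
    assume n: "n \<ge> N" and E: "\<forall>k\<in>{0, 1, 2}. (LINT y|lborel. gauss_weight c y *\<^sub>R
        (of_real y ^ k * ((1 + (of_real y)\<^sup>2) ^ n * (1 + \<i> * of_real y) ^ j * (p\<^sub>0 + p\<^sub>1 * of_real y + p\<^sub>2 * (of_real y)\<^sup>2)))) = 0"
    define f where "f k y = gauss_weight c y *\<^sub>R (of_real y ^ k * (w y * P y))" for k y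
    have E': "(LINT y|lborel. f k y) = 0" if "k \<in> {0, 1, 2}" for k
      using E that unfolding f_def w_def P_def by blast
    have intf: "integrable lborel (f k)" for k
      unfolding f_def[abs_def] w_def P_def
      by (intro integrable_gauss_weight c continuous_intros polynomially_bounded_intros polynomially_bounded_power)
    \<comment> \<open>The weight times \<open>\<bar>P\<bar>\<^sup>2\<close>, a combination of the three integrands that are known to integrate to zero.\<close>
    define g where "g y = gauss_weight c y *\<^sub>R (w y * P y * cnj (P y))" for y
    have g: "g y = cnj p\<^sub>0 * f 0 y + cnj p\<^sub>1 * f 1 y + cnj p\<^sub>2 * f 2 y" for y
      by (simp add: g_def f_def P_def[of y] scaleR_conv_of_real algebra_simps power2_eq_square)
    have g_int: "integrable lborel g" "integral\<^sup>L lborel g = 0"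
      unfolding g[abs_def] using intf E'[of 0] E'[of 1] E'[of 2] by simp_all
    have "v y * (1 + y\<^sup>2) ^ n * (cmod (P y))\<^sup>2 = \<eta> * Re (g y)" for y
    proof -
      have real: "Re (of_real a * z * of_real b) = a * b * Re z" for a b z by simp
      have "(1 + (complex_of_real y)\<^sup>2) ^ n = of_real ((1 + y\<^sup>2) ^ n)" by simp
      moreover have "P y * cnj (P y) = of_real ((cmod (P y))\<^sup>2)"
        by (simp only: complex_norm_square)
      ultimately have "g y = gauss_weight c y *\<^sub>R (of_real ((1 + y\<^sup>2) ^ n) * (1 + \<i> * of_real y) ^ j * of_real ((cmod (P y))\<^sup>2))"
        unfolding g_def w_def by (simp only: mult.assoc)
      then have "Re (g y) = gauss_weight c y * ((1 + y\<^sup>2) ^ n * (cmod (P y))\<^sup>2 * Re ((1 + \<i> * of_real y) ^ j))"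
        by (simp only: scaleR_complex.sel real)
      then show ?thesis by (simp add: v_def mult_ac)
    qed
    then have q_int: "integrable lborel (\<lambda>y. v y * (1 + y\<^sup>2) ^ n * (cmod (P y))\<^sup>2)"
      "(LINT y|lborel. v y * (1 + y\<^sup>2) ^ n * (cmod (P y))\<^sup>2) = 0"
      using g_int by (simp_all add: integral_Re)
    have "continuous_on UNIV (\<lambda>y. (cmod (P y))\<^sup>2)"
      unfolding P_def by (intro continuous_intros)
    then have zero: "P y = 0" if "\<bar>y\<bar> \<le> R" for y
      using N[OF n, of "\<lambda>y. (cmod (P y))\<^sup>2"] q_int quadratic_interpolation_bound[of _ R _ _ _ p\<^sub>0 p\<^sub>1 p\<^sub>2] that
      unfolding P_def[symmetric] C_def[symmetric] by fastforce
    have "P 0 = 0" "P 1 = 0" "P (- 1) = 0" using R by (auto intro!: zero)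
    then have "p\<^sub>0 = 0" "p\<^sub>1 + p\<^sub>2 = 0" "p\<^sub>2 - p\<^sub>1 = 0" by (simp_all add: P_def)
    then show "p\<^sub>0 = 0 \<and> p\<^sub>1 = 0 \<and> p\<^sub>2 = 0" by (auto simp: add_eq_0_iff)
  qed
qed

section \<open>Functions with few nonvanishing moments\<close>

lemma continuous_integral_nonneg_eq_0:
  fixes f :: "'a :: euclidean_space \<Rightarrow> real"
  assumes cont: "continuous_on UNIV f" and "integrable lborel f" "\<And>x. f x \<ge> 0" "integral\<^sup>L lborel f = 0"
  shows "f x = 0"
proof -
  have op: "open {x. f x \<noteq> 0}"
    by (rule open_Collect_neq[OF cont continuous_on_const])
  have "AE x in lborel. f x = 0"
    using integral_nonneg_eq_0_iff_AE[of lborel f] assms by simp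
  then have "{x \<in> space lborel. f x \<noteq> 0} \<in> null_sets lborel"
    using op by (subst (asm) AE_iff_null) auto
  then have "negligible {x. f x \<noteq> 0}"
    by (simp add: negligible_iff_null_sets null_sets_completionI)
  with op have "{x. f x \<noteq> 0} = {}"
    using open_not_negligible by blast
  then show ?thesis by blast
qed

text \<open>
  The common step of the two density arguments below: uniform approximation on the unit ball
  passes to integrals against a function supported there.
\<close>

lemma integral_zero_by_uniform_approximation:
  fixes \<phi> :: "'a :: euclidean_space \<Rightarrow> real" and h :: "'a \<Rightarrow> complex"
  assumes \<phi>: "continuous_on UNIV \<phi>"
    and h: "continuous_on UNIV h" "\<And>x. norm x \<ge> 1 \<Longrightarrow> h x = 0"
    and approx: "\<And>e. e > 0 \<Longrightarrow> \<exists>p. continuous_on UNIV p \<and> (\<forall>x. norm x \<le> 1 \<longrightarrow> \<bar>\<phi> x - p x\<bar> \<le> e)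
        \<and> (LINT x|lborel. of_real (p x) * h x) = 0"
  shows "(LINT x|lborel. of_real (\<phi> x) * h x) = 0"
proof (rule ccontr)
  define J :: real where "J = (LINT x|lborel. cmod (h x))"
  let ?I = "LINT x|lborel. of_real (\<phi> x) * h x"
  assume "?I \<noteq> 0"
  have int: "integrable lborel (\<lambda>x. of_real (p x) * h x)" if "continuous_on UNIV p" for p
    by (rule integrable_continuous_vanishing_outside_ball) (auto intro!: continuous_intros that h(1) simp: h(2))
  have inth: "integrable lborel h"
    by (rule integrable_continuous_vanishing_outside_ball) (use h in auto)
  define e where "e = cmod ?I / (2 * (J + 1))"
  have J: "J \<ge> 0" by (simp add: J_def)
  have J2: "0 < 2 * (J + 1)" using J by (intro mult_pos_pos add_nonneg_pos) auto
  have e: "e > 0" unfolding e_def using \<open>?I \<noteq> 0\<close> by (intro divide_pos_pos J2) simp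
  obtain p where p: "continuous_on UNIV p" "\<And>x. norm x \<le> 1 \<Longrightarrow> \<bar>\<phi> x - p x\<bar> \<le> e"
    "(LINT x|lborel. of_real (p x) * h x) = 0"
    using approx[OF e] by blast
  have "?I = (LINT x|lborel. of_real (\<phi> x) * h x - of_real (p x) * h x)"
    using p(3) int[OF \<phi>] int[OF p(1)] by simp
  then have "cmod ?I \<le> (LINT x|lborel. cmod (of_real (\<phi> x) * h x - of_real (p x) * h x))"
    by (simp only: integral_norm_bound)
  also have "\<dots> \<le> (LINT x|lborel. e * cmod (h x))"
  proof (rule integral_mono)
    fix x
    have "cmod (of_real (\<phi> x) * h x - of_real (p x) * h x) = \<bar>\<phi> x - p x\<bar> * cmod (h x)"
      by (simp add: left_diff_distrib[symmetric] norm_mult flip: of_real_diff)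
    also have "\<dots> \<le> e * cmod (h x)"
      using p(2)[of x] h(2)[of x] by (cases "norm x \<le> 1") (auto intro: mult_right_mono)
    finally show "cmod (of_real (\<phi> x) * h x - of_real (p x) * h x) \<le> e * cmod (h x)" .
  qed (use int[OF \<phi>] int[OF p(1)] inth in auto)
  also have "\<dots> = e * J" by (simp add: J_def)
  also have "\<dots> < e * (2 * (J + 1))" using e J by (intro mult_strict_left_mono) auto
  also have "\<dots> = cmod ?I" using J by (simp add: e_def)
  finally show False by simp
qed

lemma radial_moments_zero_imp_radial_averages_zero:
  fixes h :: "'a :: euclidean_space \<Rightarrow> complex" and q :: "real \<Rightarrow> real"
  assumes h: "continuous_on UNIV h" "\<And>x. norm x \<ge> 1 \<Longrightarrow> h x = 0"
    and mom: "\<And>i. (LINT x|lborel. of_real ((norm x)\<^sup>2 ^ i) * h x) = 0"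
    and q: "continuous_on UNIV q"
  shows "(LINT x|lborel. of_real (q ((norm x)\<^sup>2)) * h x) = 0"
proof (rule integral_zero_by_uniform_approximation[OF _ h])
  show "continuous_on UNIV (\<lambda>x::'a. q ((norm x)\<^sup>2))"
    by (rule continuous_on_compose2[OF q]) (auto intro!: continuous_intros)
  fix e :: real assume "e > 0"
  then obtain p where "real_polynomial_function p" and p: "\<And>t. t \<in> {0..1} \<Longrightarrow> \<bar>q t - p t\<bar> < e"
    using Stone_Weierstrass_real_polynomial_function[of "{0..1}" q e] continuous_on_subset[OF q] by auto
  then obtain a n where pa: "p = (\<lambda>x. \<Sum>i\<le>n. a i * x ^ i)" by (auto simp: real_polynomial_function_iff_sum)
  have int: "integrable lborel (\<lambda>x. of_real (a i) * (of_real ((norm x)\<^sup>2 ^ i) * h x))" for i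
    by (intro integrable_mult_right integrable_continuous_vanishing_outside_ball)
      (auto intro!: continuous_intros h(1) simp: h(2))
  have "(LINT x|lborel. of_real (p ((norm x)\<^sup>2)) * h x) =
      (LINT x|lborel. (\<Sum>i\<le>n. of_real (a i) * (of_real ((norm x)\<^sup>2 ^ i) * h x)))"
    by (simp add: pa sum_distrib_right mult.assoc)
  also have "\<dots> = 0"
    using int mom by (simp add: Bochner_Integration.integral_sum del: of_real_power of_real_mult)
  finally have "(LINT x|lborel. of_real (p ((norm x)\<^sup>2)) * h x) = 0" .
  moreover have "continuous_on UNIV (\<lambda>x::'a. p ((norm x)\<^sup>2))"
    unfolding pa by (intro continuous_intros)
  moreover have "\<bar>q ((norm x)\<^sup>2) - p ((norm x)\<^sup>2)\<bar> \<le> e" if "norm x \<le> 1" for x :: 'a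
    using p[of "(norm x)\<^sup>2"] that by (simp add: power_le_one less_imp_le)
  ultimately show "\<exists>p. continuous_on UNIV p \<and> (\<forall>x::'a. norm x \<le> 1 \<longrightarrow> \<bar>q ((norm x)\<^sup>2) - p x\<bar> \<le> e)
        \<and> (LINT x|lborel. of_real (p x) * h x) = 0" by blast
qed

definition to_complex :: "real^2 \<Rightarrow> complex" where
  "to_complex x = Complex (x $ 1) (x $ 2)"

lemma to_complex_eq: "to_complex x = of_real (x $ 1) + \<i> * of_real (x $ 2)"
  by (simp add: to_complex_def complex_eq_iff)

lemma continuous_on_to_complex [continuous_intros]: "continuous_on S to_complex"
  unfolding to_complex_eq[abs_def] by (intro continuous_intros)

lemma to_complex_times_cnj: "to_complex x * cnj (to_complex x) = of_real ((norm x)\<^sup>2)"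
proof -
  have "(norm x)\<^sup>2 = (x $ 1)\<^sup>2 + (x $ 2)\<^sup>2"
    by (simp add: norm_vec_def L2_set_def sum_2)
  then show ?thesis by (simp add: to_complex_def complex_eq_iff power2_eq_square)
qed

definition plane_moment :: "(real^2 \<Rightarrow> complex) \<Rightarrow> nat \<Rightarrow> nat \<Rightarrow> complex" where
  "plane_moment g m n = (LINT x|lborel. to_complex x ^ m * cnj (to_complex x) ^ n * g x)"

lemma integrable_plane_moment:
  assumes "continuous_on UNIV g" "\<And>x. norm x \<ge> 1 \<Longrightarrow> g x = 0"
  shows "integrable lborel (\<lambda>x. to_complex x ^ m * cnj (to_complex x) ^ n * g x)"
  by (rule integrable_continuous_vanishing_outside_ball) (auto intro!: continuous_intros assms(1) simp: assms(2))

text \<open>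
  The statement is kept for all moments of \<open>p G\<close>, not only for its integral, so that it is preserved
  under products of polynomials. A linear form is a combination of \<open>z\<close> and \<open>cnj z\<close>, which only shifts
  the exponents.
\<close>

lemma plane_moments_zero_imp_polynomial_integral_zero:
  assumes "real_polynomial_function p"
    and "continuous_on UNIV G" "\<And>x. norm x \<ge> 1 \<Longrightarrow> G x = 0" "\<And>m n. plane_moment G m n = 0"
  shows "plane_moment (\<lambda>x. of_real (p x) * G x) m n = 0"
  using assms
proof (induction arbitrary: G m n rule: real_polynomial_function.induct)
  case (linear f)
  define \<alpha> \<beta> where "\<alpha> = f (axis 1 1)" and "\<beta> = f (axis 2 1)"
  define \<gamma> where "\<gamma> = Complex (\<alpha> / 2) (- \<beta> / 2)"
  have f: "f x = \<alpha> * x $ 1 + \<beta> * x $ 2" for x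
  proof -
    have "x = (x $ 1) *\<^sub>R axis 1 1 + (x $ 2) *\<^sub>R axis 2 1"
      by (simp add: vec_eq_iff forall_2 axis_def)
    then have "f x = f ((x $ 1) *\<^sub>R axis 1 1 + (x $ 2) *\<^sub>R axis 2 1)" by simp
    also have "\<dots> = \<alpha> * x $ 1 + \<beta> * x $ 2"
      using linear(1) by (simp add: linear_simps \<alpha>_def \<beta>_def)
    finally show ?thesis .
  qed
  have eq: "of_real (f x) = \<gamma> * to_complex x + cnj \<gamma> * cnj (to_complex x)" for x
    by (simp add: f complex_eq_iff \<gamma>_def to_complex_def)
  have "plane_moment (\<lambda>x. of_real (f x) * G x) m n =
     (LINT x|lborel. \<gamma> * (to_complex x ^ Suc m * cnj (to_complex x) ^ n * G x) + cnj \<gamma> * (to_complex x ^ m * cnj (to_complex x) ^ Suc n * G x))"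
    unfolding plane_moment_def eq by (rule Bochner_Integration.integral_cong) (simp_all add: algebra_simps)
  also have "\<dots> = \<gamma> * plane_moment G (Suc m) n + cnj \<gamma> * plane_moment G m (Suc n)"
    unfolding plane_moment_def
    using integrable_plane_moment[OF linear(2,3), of "Suc m" n] integrable_plane_moment[OF linear(2,3), of m "Suc n"]
    by (subst Bochner_Integration.integral_add) (simp_all del: power_Suc)
  finally show ?case using linear(4) by simp
next
  case (const c)
  have "plane_moment (\<lambda>x. of_real c * G x) m n = of_real c * plane_moment G m n"
    unfolding plane_moment_def by (simp add: mult.left_commute[of _ "of_real c"])
  then show ?case using const by simp
next
  case (add f g)
  have cont: "continuous_on UNIV (\<lambda>x. of_real (r x) * G x)" if "real_polynomial_function r" for r
    using continuous_on_polymonial_function[of r UNIV] that add.prems(1)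
    by (intro continuous_intros) (simp_all add: real_polynomial_function_eq)
  have "plane_moment (\<lambda>x. of_real (f x + g x) * G x) m n =
      plane_moment (\<lambda>x. of_real (f x) * G x) m n + plane_moment (\<lambda>x. of_real (g x) * G x) m n"
  proof -
    have int: "integrable lborel (\<lambda>x. to_complex x ^ m * cnj (to_complex x) ^ n * (of_real (r x) * G x))"
      if "real_polynomial_function r" for r
      by (rule integrable_plane_moment[OF cont[OF that]]) (simp add: add.prems(2))
    show ?thesis
      unfolding plane_moment_def Bochner_Integration.integral_add[OF int[OF add.hyps(1)] int[OF add.hyps(2)], symmetric]
      by (rule Bochner_Integration.integral_cong) (simp_all add: algebra_simps)
  qed
  then show ?case using add by simp
next
  case (mult f g)
  have "continuous_on UNIV (\<lambda>x. of_real (g x) * G x)"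
    using continuous_on_polymonial_function[of g UNIV] mult.hyps mult.prems(1)
    by (intro continuous_intros) (simp_all add: real_polynomial_function_eq)
  then have "plane_moment (\<lambda>x. of_real (f x) * (of_real (g x) * G x)) m n = 0"
    using mult.prems by (intro mult.IH(1) mult.IH(2)) auto
  then show ?case by (simp add: mult.assoc)
qed

lemma continuous_eq_0_if_plane_moments_zero:
  assumes G: "continuous_on UNIV G" "\<And>x. norm x \<ge> 1 \<Longrightarrow> G x = 0" "\<And>m n. plane_moment G m n = 0"
  shows "G x = 0"
proof -
  have zero: "(LINT x|lborel. of_real (\<phi> x) * G x) = 0" if \<phi>: "continuous_on UNIV \<phi>" for \<phi> :: "real^2 \<Rightarrow> real"
  proof (rule integral_zero_by_uniform_approximation[OF \<phi> G(1,2)])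
    fix e :: real assume "e > 0"
    then obtain p where p: "real_polynomial_function p" and "\<And>x. x \<in> cball 0 1 \<Longrightarrow> \<bar>\<phi> x - p x\<bar> < e"
      using Stone_Weierstrass_real_polynomial_function[of "cball 0 1" \<phi> e] continuous_on_subset[OF \<phi>] by auto
    moreover have "(LINT x|lborel. of_real (p x) * G x) = 0"
      using plane_moments_zero_imp_polynomial_integral_zero[OF p G, of 0 0] by (simp add: plane_moment_def)
    moreover have "continuous_on UNIV p"
      using p by (intro continuous_on_polymonial_function) (simp add: real_polynomial_function_eq)
    ultimately show "\<exists>p. continuous_on UNIV p \<and> (\<forall>x. norm x \<le> 1 \<longrightarrow> \<bar>\<phi> x - p x\<bar> \<le> e)
        \<and> (LINT x|lborel. of_real (p x) * G x) = 0"
      by (intro exI[of _ p]) (auto intro: less_imp_le)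
  qed
  have int: "integrable lborel (\<lambda>x. of_real (\<phi> x) * G x)" if "continuous_on UNIV \<phi>" for \<phi> :: "real^2 \<Rightarrow> real"
    by (rule integrable_continuous_vanishing_outside_ball) (auto intro!: continuous_intros that G(1) simp: G(2))
  have cR: "continuous_on UNIV (\<lambda>x. Re (G x))" and cI: "continuous_on UNIV (\<lambda>x. Im (G x))"
    by (intro continuous_intros G(1))+
  have "Re (G x) ^ 2 = 0"
  proof (rule continuous_integral_nonneg_eq_0[where f = "\<lambda>x. Re (G x) ^ 2"])
    show "continuous_on UNIV (\<lambda>x. Re (G x) ^ 2)" by (intro continuous_intros G(1))
    have "(\<lambda>x. Re (G x) ^ 2) = (\<lambda>x. Re (of_real (Re (G x)) * G x))"
      by (simp add: power2_eq_square)
    then show "integrable lborel (\<lambda>x. Re (G x) ^ 2)" "(LINT x|lborel. Re (G x) ^ 2) = 0"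
      using int[OF cR] zero[OF cR] by (simp_all only: integral_Re integrable_Re) simp
  qed simp
  moreover have "Im (G x) ^ 2 = 0"
  proof (rule continuous_integral_nonneg_eq_0[where f = "\<lambda>x. Im (G x) ^ 2"])
    show "continuous_on UNIV (\<lambda>x. Im (G x) ^ 2)" by (intro continuous_intros G(1))
    have "(\<lambda>x. Im (G x) ^ 2) = (\<lambda>x. Im (of_real (Im (G x)) * G x))"
      by (simp add: power2_eq_square)
    then show "integrable lborel (\<lambda>x. Im (G x) ^ 2)" "(LINT x|lborel. Im (G x) ^ 2) = 0"
      using int[OF cI] zero[OF cI] by (simp_all only: integral_Im integrable_Im) simp
  qed simp
  ultimately show ?thesis by (simp add: complex_eq_iff)
qed

text \<open>
  For a fixed difference of the exponents, the surviving moments all contain a high power of \<open>\<bar>z\<bar>\<^sup>2\<close>.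
  Multiplying \<open>g\<close> by a radial function that is zero near the origin absorbs this power, and by
  approximation all moments of the product vanish, also the low ones. As the cutoff is arbitrarily small,
  \<open>g\<close> is zero off the origin, and at the origin by continuity.
\<close>

lemma continuous_eq_0_if_high_plane_moments_zero:
  assumes g: "continuous_on UNIV g" "\<And>x. norm x \<ge> 1 \<Longrightarrow> g x = 0"
    and mom: "\<And>j. \<exists>N. \<forall>n\<ge>N. plane_moment g (j + n) n = 0 \<and> plane_moment g n (j + n) = 0"
  shows "g = (\<lambda>x. 0)"
proof -
  have off_origin: "g x = 0" if "x \<noteq> 0" for x
  proof -
    define \<epsilon> where "\<epsilon> = (norm x)\<^sup>2 / 2"
    have \<epsilon>: "\<epsilon> > 0" using that by (simp add: \<epsilon>_def)
    define \<kappa> where "\<kappa> t = max 0 (t - \<epsilon>)" for t :: real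
    define G where "G x = of_real (\<kappa> ((norm x)\<^sup>2)) * g x" for x
    have c\<kappa>: "continuous_on S \<kappa>" for S unfolding \<kappa>_def[abs_def] by (intro continuous_intros)
    have cG: "continuous_on UNIV G" unfolding G_def[abs_def] \<kappa>_def by (intro continuous_intros g(1))
    have zG: "G x = 0" if "norm x \<ge> 1" for x using g(2)[OF that] by (simp add: G_def)
    have key: "(LINT x|lborel. of_real ((norm x)\<^sup>2 ^ b) * (m x * G x)) = 0"
      if N: "\<forall>n\<ge>N. (LINT x|lborel. of_real ((norm x)\<^sup>2 ^ n) * (m x * g x)) = 0"
        and m: "continuous_on UNIV m" for m :: "real^2 \<Rightarrow> complex" and b N
    proof -
      \<comment> \<open>Division by \<open>t\<^sup>N\<close> is harmless because \<open>\<kappa>\<close> is zero below \<open>\<epsilon>\<close>; the maximum makes \<open>q\<close> continuous at \<open>0\<close>.\<close>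
      define q where "q t = t ^ b * \<kappa> t / max t \<epsilon> ^ N" for t
      have q: "q t * t ^ N = t ^ b * \<kappa> t" for t
        using \<epsilon> by (cases "t \<ge> \<epsilon>") (auto simp: q_def \<kappa>_def max_def)
      have cq: "continuous_on UNIV q"
        unfolding q_def[abs_def] by (intro continuous_intros c\<kappa>) (use \<epsilon> in \<open>auto simp: max_def\<close>)
      define h where "h x = of_real ((norm x)\<^sup>2 ^ N) * (m x * g x)" for x
      have "(LINT x|lborel. of_real (q ((norm x)\<^sup>2)) * h x) = 0"
      proof (rule radial_moments_zero_imp_radial_averages_zero[OF _ _ _ cq])
        show "continuous_on UNIV h" unfolding h_def[abs_def] by (intro continuous_intros m g(1))
        show "h x = 0" if "norm x \<ge> 1" for x using g(2)[OF that] by (simp add: h_def)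
        fix i
        have "of_real ((norm x)\<^sup>2 ^ i) * h x = of_real ((norm x)\<^sup>2 ^ (i + N)) * (m x * g x)" for x
          by (simp add: h_def power_add mult.assoc)
        then show "(LINT x|lborel. of_real ((norm x)\<^sup>2 ^ i) * h x) = 0" using N by simp
      qed
      moreover have "of_real (q ((norm x)\<^sup>2)) * h x = of_real ((norm x)\<^sup>2 ^ b) * (m x * G x)" for x
      proof -
        have "of_real (q ((norm x)\<^sup>2)) * h x = of_real (q ((norm x)\<^sup>2) * (norm x)\<^sup>2 ^ N) * (m x * g x)"
          unfolding h_def by (simp only: of_real_mult mult.assoc)
        then show ?thesis unfolding q G_def by (simp only: of_real_mult mult_ac)
      qed
      ultimately show ?thesis by simp
    qed
    have norm_pow: "of_real ((norm x)\<^sup>2 ^ n) = (to_complex x * cnj (to_complex x)) ^ n" for x n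
      by (simp only: to_complex_times_cnj of_real_power)
    have split1: "to_complex x ^ (j + n) * cnj (to_complex x) ^ n * f x = of_real ((norm x)\<^sup>2 ^ n) * (to_complex x ^ j * f x)" for j n f x
      by (simp only: norm_pow power_add power_mult_distrib mult_ac)
    have split2: "to_complex x ^ n * cnj (to_complex x) ^ (j + n) * f x = of_real ((norm x)\<^sup>2 ^ n) * (cnj (to_complex x) ^ j * f x)" for j n f x
      by (simp only: norm_pow power_add power_mult_distrib mult_ac)
    have momG: "plane_moment G (j + b) b = 0 \<and> plane_moment G b (j + b) = 0" for j b
    proof -
      obtain N where N: "\<forall>n\<ge>N. plane_moment g (j + n) n = 0 \<and> plane_moment g n (j + n) = 0"
        using mom by blast
      have "plane_moment G (j + b) b = 0"
        using N unfolding plane_moment_def split1 by (intro key[of N]) (auto intro!: continuous_intros)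
      moreover have "plane_moment G b (j + b) = 0"
        using N unfolding plane_moment_def split2 by (intro key[of N]) (auto intro!: continuous_intros)
      ultimately show ?thesis by blast
    qed
    have "plane_moment G a b = 0" for a b
      using momG[of "a - b" b] momG[of "b - a" a] by (cases "a \<ge> b") auto
    then have "G x = 0" using continuous_eq_0_if_plane_moments_zero[OF cG zG] by blast
    moreover have "\<kappa> ((norm x)\<^sup>2) > 0" using \<epsilon> by (simp add: \<kappa>_def \<epsilon>_def)
    ultimately show ?thesis by (simp add: G_def)
  qed
  have "(g \<longlongrightarrow> g 0) (at 0)"
    using g(1) by (simp add: continuous_on_def)
  moreover have "(g \<longlongrightarrow> 0) (at 0)"
    by (rule tendsto_eventually) (auto simp: eventually_at_filter off_origin)
  ultimately have "g 0 = 0" by (rule tendsto_unique[rotated]) (rule trivial_limit_at)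
  with off_origin show ?thesis by (metis (full_types))
qed

section \<open>Fourier coefficients in the angle\<close>

text \<open>
  The coefficients that appear when \<open>y\<^sup>k (a + y b)\<^sup>d\<close> is averaged and expanded in \<open>z\<close> and \<open>cnj z\<close>.
\<close>

definition cayley_gauss_moment :: "real \<Rightarrow> nat \<Rightarrow> nat \<Rightarrow> nat \<Rightarrow> complex" where
  "cayley_gauss_moment c k m n =
     (LINT y|lborel. gauss_weight c y *\<^sub>R (of_real y ^ k * ((1 - \<i> * of_real y) ^ m * (1 + \<i> * of_real y) ^ n)))"

lemma integrable_cayley_gauss:
  assumes "c > 0"
  shows "integrable lborel (\<lambda>y. gauss_weight c y *\<^sub>R (of_real y ^ k * ((1 - \<i> * of_real y) ^ m * (1 + \<i> * of_real y) ^ n)))"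
  by (intro integrable_gauss_weight assms continuous_intros polynomially_bounded_intros polynomially_bounded_power)

text \<open>
  Since \<open>to_complex x * cis (- \<theta>) = a + \<i> b\<close>, the number \<open>a + y b\<close> is the real part of \<open>(1 - \<i> y) (a + \<i> b)\<close>, that is,
  half the sum of this product and its conjugate.
\<close>

lemma gaussian_average_power_expansion:
  assumes c: "c > 0"
  shows "of_real (LINT y|lborel. y ^ k * gauss_weight c y * (dir \<theta> \<bullet> x + y * (dir_perp \<theta> \<bullet> x)) ^ d) =
    (\<Sum>m\<le>d. of_nat (d choose m) / 2 ^ d * cayley_gauss_moment c k m (d - m) * cis (- \<theta>) ^ m * cis \<theta> ^ (d - m)
        * (to_complex x ^ m * cnj (to_complex x) ^ (d - m)))"
proof -
  have lin: "of_real (dir \<theta> \<bullet> x + y * (dir_perp \<theta> \<bullet> x)) =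
      ((1 - \<i> * of_real y) * (cis (- \<theta>) * to_complex x) + (1 + \<i> * of_real y) * (cis \<theta> * cnj (to_complex x))) / 2" for y
    by (simp add: complex_eq_iff to_complex_def dir_def dir_perp_def inner_vec_def sum_2 algebra_simps)
  have pow: "of_real ((dir \<theta> \<bullet> x + y * (dir_perp \<theta> \<bullet> x)) ^ d) =
      (\<Sum>m\<le>d. of_nat (d choose m) / 2 ^ d * cis (- \<theta>) ^ m * cis \<theta> ^ (d - m) * (to_complex x ^ m * cnj (to_complex x) ^ (d - m))
        * ((1 - \<i> * of_real y) ^ m * (1 + \<i> * of_real y) ^ (d - m)))" for y
  proof -
    have "of_real ((dir \<theta> \<bullet> x + y * (dir_perp \<theta> \<bullet> x)) ^ d) =
        ((1 - \<i> * of_real y) * (cis (- \<theta>) * to_complex x) + (1 + \<i> * of_real y) * (cis \<theta> * cnj (to_complex x))) ^ d / 2 ^ d"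
      by (simp only: of_real_power lin power_divide)
    also have "\<dots> = (\<Sum>m\<le>d. of_nat (d choose m) / 2 ^ d * cis (- \<theta>) ^ m * cis \<theta> ^ (d - m) * (to_complex x ^ m * cnj (to_complex x) ^ (d - m))
        * ((1 - \<i> * of_real y) ^ m * (1 + \<i> * of_real y) ^ (d - m)))"
      unfolding binomial_ring[of "(1 - \<i> * of_real y) * (cis (- \<theta>) * to_complex x)"] sum_divide_distrib
      by (rule sum.cong[OF refl]) (simp only: power_mult_distrib divide_inverse mult_ac)
    finally show ?thesis .
  qed
  have "of_real (LINT y|lborel. y ^ k * gauss_weight c y * (dir \<theta> \<bullet> x + y * (dir_perp \<theta> \<bullet> x)) ^ d) =
     (LINT y|lborel. complex_of_real (y ^ k * gauss_weight c y * (dir \<theta> \<bullet> x + y * (dir_perp \<theta> \<bullet> x)) ^ d))"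
    by (rule integral_complex_of_real[symmetric])
  also have "\<dots> = (LINT y|lborel. (\<Sum>m\<le>d. (of_nat (d choose m) / 2 ^ d * cis (- \<theta>) ^ m * cis \<theta> ^ (d - m) * (to_complex x ^ m * cnj (to_complex x) ^ (d - m)))
        * (gauss_weight c y *\<^sub>R (of_real y ^ k * ((1 - \<i> * of_real y) ^ m * (1 + \<i> * of_real y) ^ (d - m))))))"
  proof (rule Bochner_Integration.integral_cong[OF refl])
    fix y :: real
    have "complex_of_real (y ^ k * gauss_weight c y * (dir \<theta> \<bullet> x + y * (dir_perp \<theta> \<bullet> x)) ^ d)
      = of_real y ^ k * of_real (gauss_weight c y) * of_real ((dir \<theta> \<bullet> x + y * (dir_perp \<theta> \<bullet> x)) ^ d)"
      by simp
    also have "\<dots> = (\<Sum>m\<le>d. (of_nat (d choose m) / 2 ^ d * cis (- \<theta>) ^ m * cis \<theta> ^ (d - m) * (to_complex x ^ m * cnj (to_complex x) ^ (d - m)))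
        * (gauss_weight c y *\<^sub>R (of_real y ^ k * ((1 - \<i> * of_real y) ^ m * (1 + \<i> * of_real y) ^ (d - m)))))"
      unfolding pow sum_distrib_left scaleR_conv_of_real by (rule sum.cong) (simp_all only: mult_ac)
    finally show "complex_of_real (y ^ k * gauss_weight c y * (dir \<theta> \<bullet> x + y * (dir_perp \<theta> \<bullet> x)) ^ d)
      = (\<Sum>m\<le>d. (of_nat (d choose m) / 2 ^ d * cis (- \<theta>) ^ m * cis \<theta> ^ (d - m) * (to_complex x ^ m * cnj (to_complex x) ^ (d - m)))
        * (gauss_weight c y *\<^sub>R (of_real y ^ k * ((1 - \<i> * of_real y) ^ m * (1 + \<i> * of_real y) ^ (d - m)))))" .
  qed
  also have "\<dots> = (\<Sum>m\<le>d. (of_nat (d choose m) / 2 ^ d * cis (- \<theta>) ^ m * cis \<theta> ^ (d - m) * (to_complex x ^ m * cnj (to_complex x) ^ (d - m)))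
        * cayley_gauss_moment c k m (d - m))"
    unfolding cayley_gauss_moment_def
    by (subst Bochner_Integration.integral_sum)
      (intro integrable_mult_right integrable_cayley_gauss c sum.cong refl integral_mult_right_zero)+
  finally show ?thesis by (simp only: mult_ac)
qed

text \<open>
  A polynomial with infinitely many zeros has zero coefficients; the three families of coefficients meet
  in degree \<open>p + 2\<close> of the polynomial in \<open>v\<close>.
\<close>

lemma shifted_polynomial_coefficients_zero:
  fixes \<alpha> \<beta> \<gamma> :: "nat \<Rightarrow> complex"
  assumes "infinite V" and zero: "\<And>v. v \<in> V \<Longrightarrow> (\<Sum>m\<le>d. v ^ m * (\<alpha> m * v + \<beta> m * v\<^sup>2 + \<gamma> m)) = 0"
    and p: "p + 2 \<le> d"
  shows "\<alpha> (p + 1) + \<beta> p + \<gamma> (p + 2) = 0"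
proof -
  define S where "S \<delta> = (\<Sum>m\<le>d. monom (\<delta> m) m)" for \<delta> :: "nat \<Rightarrow> complex"
  have cS: "coeff (S \<delta>) m = \<delta> m" if "m \<le> d" for \<delta> m
    using that by (simp add: S_def coeff_sum)
  have pS: "poly (S \<delta>) v = (\<Sum>m\<le>d. \<delta> m * v ^ m)" for \<delta> v
    by (simp add: S_def poly_sum poly_monom)
  define Q where "Q = pCons 0 (S \<alpha>) + pCons 0 (pCons 0 (S \<beta>)) + S \<gamma>"
  have "poly Q v = (\<Sum>m\<le>d. v ^ m * (\<alpha> m * v + \<beta> m * v\<^sup>2 + \<gamma> m))" for v
    by (simp add: Q_def pS sum_distrib_left sum.distrib[symmetric] power2_eq_square algebra_simps)
  then have "V \<subseteq> {v. poly Q v = 0}" using zero by auto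
  then have "infinite {v. poly Q v = 0}" using \<open>infinite V\<close> finite_subset by blast
  then have "Q = 0" using poly_roots_finite by blast
  then have "coeff Q (p + 2) = 0" by simp
  then show ?thesis using p by (simp add: Q_def cS numeral_2_eq_2)
qed

lemma infinite_double_angle_phases: "infinite ((\<lambda>\<theta>. cis (- \<theta>) ^ 2) ` {0..<2 * pi})"
proof
  assume "finite ((\<lambda>\<theta>. cis (- \<theta>) ^ 2) ` {0..<2 * pi})"
  moreover have "(\<lambda>\<theta>. cis (- \<theta>) ^ 2) ` {0..1} \<subseteq> (\<lambda>\<theta>. cis (- \<theta>) ^ 2) ` {0..<2 * pi}"
    using pi_gt3 by (intro image_mono) auto
  ultimately have "finite ((\<lambda>\<theta>. cis (- \<theta>) ^ 2) ` {0..1})" by (rule finite_subset[rotated])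
  moreover have "inj_on (\<lambda>\<theta>. cis (- \<theta>) ^ 2) {0..1}"
  proof (rule inj_onI)
    fix s t :: real assume st: "s \<in> {0..1}" "t \<in> {0..1}" and eq: "cis (- s) ^ 2 = cis (- t) ^ 2"
    have double: "Re (cis (- r) ^ 2) = cos (2 * r)" for r
      by (simp only: Complex.DeMoivre cis.sel) simp
    have "cos (2 * s) = Re (cis (- s) ^ 2)" by (rule double[symmetric])
    also have "\<dots> = cos (2 * t)" unfolding eq by (rule double)
    finally have "cos (2 * s) = cos (2 * t)" .
    moreover have "0 \<le> 2 * s" "2 * s \<le> pi" "0 \<le> 2 * t" "2 * t \<le> pi"
      using st pi_gt3 by auto
    ultimately have "2 * s = 2 * t" using cos_inj_pi[of "2 * s" "2 * t"] by blast
    then show "s = t" by simp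
  qed
  ultimately have "finite {0..1::real}" by (rule finite_imageD)
  then show False by (simp add: infinite_Icc)
qed

text \<open>
  After multiplication with \<open>cis (- \<theta>) ^ (d + 2)\<close> the integrated data become a polynomial in \<open>v = cis (- \<theta>)\<^sup>2\<close>. Its
  coefficient of degree \<open>p + 2\<close> collects one moment of \<open>C\<close>, one of \<open>A\<close> and one of the conjugate of \<open>A\<close>.
\<close>

lemma tensor_moment_relations:
  fixes A C :: "real^2 \<Rightarrow> complex" and F :: "real \<Rightarrow> real^2 \<Rightarrow> real"
  assumes c: "c > 0"
    and A: "continuous_on UNIV A" "\<And>x. norm x \<ge> 1 \<Longrightarrow> A x = 0"
    and C: "continuous_on UNIV C" "\<And>x. norm x \<ge> 1 \<Longrightarrow> C x = 0"
    and F: "\<And>\<theta> x. of_real (F \<theta> x) = C x / 2 - (cis (- \<theta>) ^ 2 * A x + cis \<theta> ^ 2 * cnj (A x)) / 4"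
    and data: "\<And>\<theta>. \<theta> \<in> {0..<2 * pi} \<Longrightarrow>
      (LINT x|lborel. F \<theta> x * (LINT y|lborel. y ^ k * gauss_weight c y * (dir \<theta> \<bullet> x + y * (dir_perp \<theta> \<bullet> x)) ^ (p + q + 2))) = 0"
  defines "d \<equiv> p + q + 2"
  shows "of_nat (d choose (p + 1)) * cayley_gauss_moment c k (p + 1) (q + 1) * (plane_moment C (p + 1) (q + 1) / 2)
       - of_nat (d choose p) * cayley_gauss_moment c k p (q + 2) * (plane_moment A p (q + 2) / 4)
       - of_nat (d choose (p + 2)) * cayley_gauss_moment c k (p + 2) q * (plane_moment (\<lambda>x. cnj (A x)) (p + 2) q / 4) = 0"
proof -
  define \<kappa> where "\<kappa> m = of_nat (d choose m) * cayley_gauss_moment c k m (d - m)" for m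
  define B where "B x = cnj (A x)" for x
  have B: "continuous_on UNIV B" "\<And>x. norm x \<ge> 1 \<Longrightarrow> B x = 0"
    unfolding B_def[abs_def] by (intro continuous_intros A(1)) (simp add: A(2))
  define \<alpha> where "\<alpha> m = \<kappa> m * (plane_moment C m (d - m) / 2)" for m
  define \<beta> where "\<beta> m = - \<kappa> m * (plane_moment A m (d - m) / 4)" for m
  define \<gamma> where "\<gamma> m = - \<kappa> m * (plane_moment B m (d - m) / 4)" for m
  have zero: "(\<Sum>m\<le>d. v ^ m * (\<alpha> m * v + \<beta> m * v\<^sup>2 + \<gamma> m)) = 0"
    if vV: "v \<in> (\<lambda>\<theta>. cis (- \<theta>) ^ 2) ` {0..<2 * pi}" for v
  proof -
    obtain \<theta> where \<theta>: "\<theta> \<in> {0..<2 * pi}" and v: "v = cis (- \<theta>) ^ 2" using vV by blast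
    define u where "u = cis (- \<theta>)"
    define u' where "u' = cis \<theta>"
    have uu': "u * u' = 1" by (simp add: u_def u'_def cis_mult)
    have distribute: "(z / 2 - (u1 * z1 + u2 * z2) / 4) * (K * M) =
        K * (M * z / 2 - u1 * (M * z1) / 4 - u2 * (M * z2) / 4)" for z z1 z2 u1 u2 K M :: complex
      by (simp add: field_simps)
    define T where "T m x = (of_nat (d choose m) / 2 ^ d * cayley_gauss_moment c k m (d - m) * u ^ m * u' ^ (d - m)) *
      ((to_complex x ^ m * cnj (to_complex x) ^ (d - m) * C x) / 2 - u\<^sup>2 * (to_complex x ^ m * cnj (to_complex x) ^ (d - m) * A x) / 4
        - u'\<^sup>2 * (to_complex x ^ m * cnj (to_complex x) ^ (d - m) * B x) / 4)" for m x
    have intT: "integrable lborel (T m)" for m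
      unfolding T_def[abs_def]
      by (intro integrable_mult_right Bochner_Integration.integrable_diff integrable_divide
            integrable_plane_moment A B C)
    have LT: "(LINT x|lborel. T m x) = (of_nat (d choose m) / 2 ^ d * cayley_gauss_moment c k m (d - m) * u ^ m * u' ^ (d - m)) *
       (plane_moment C m (d - m) / 2 - u\<^sup>2 * plane_moment A m (d - m) / 4 - u'\<^sup>2 * plane_moment B m (d - m) / 4)" for m
      unfolding T_def plane_moment_def
      using integrable_plane_moment[OF A, of m "d - m"] integrable_plane_moment[OF B, of m "d - m"]
        integrable_plane_moment[OF C, of m "d - m"]
      by simp
    have "0 = complex_of_real (LINT x|lborel. F \<theta> x * (LINT y|lborel. y ^ k * gauss_weight c y * (dir \<theta> \<bullet> x + y * (dir_perp \<theta> \<bullet> x)) ^ d))"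
      using data[OF \<theta>] by (simp add: d_def)
    also have "\<dots> = (LINT x|lborel. complex_of_real (F \<theta> x * (LINT y|lborel. y ^ k * gauss_weight c y * (dir \<theta> \<bullet> x + y * (dir_perp \<theta> \<bullet> x)) ^ d)))"
      by (rule integral_complex_of_real[symmetric])
    also have "\<dots> = (LINT x|lborel. (\<Sum>m\<le>d. T m x))"
    proof (rule Bochner_Integration.integral_cong[OF refl])
      fix x
      show "complex_of_real (F \<theta> x * (LINT y|lborel. y ^ k * gauss_weight c y * (dir \<theta> \<bullet> x + y * (dir_perp \<theta> \<bullet> x)) ^ d)) = (\<Sum>m\<le>d. T m x)"
        unfolding of_real_mult F gaussian_average_power_expansion[OF c] sum_distrib_left
        unfolding T_def u_def u'_def B_def by (rule sum.cong[OF refl]) (rule distribute)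
    qed
    also have "\<dots> = (\<Sum>m\<le>d. (LINT x|lborel. T m x))"
      using intT by (rule Bochner_Integration.integral_sum)
    finally have "0 = u ^ (d + 2) * 2 ^ d * (\<Sum>m\<le>d. (LINT x|lborel. T m x))" by simp
    also have "\<dots> = (\<Sum>m\<le>d. v ^ m * (\<alpha> m * v + \<beta> m * v\<^sup>2 + \<gamma> m))"
      unfolding sum_distrib_left
    proof (rule sum.cong[OF refl])
      fix m assume m: "m \<in> {..d}"
      have ud: "u ^ d * u ^ m * u' ^ (d - m) = v ^ m"
      proof -
        have "u ^ d = u ^ m * u ^ (d - m)" using m by (simp flip: power_add)
        then have "u ^ d * u ^ m * u' ^ (d - m) = u ^ m * u ^ m * (u * u') ^ (d - m)"
          by (simp only: power_mult_distrib mult_ac)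
        then show ?thesis by (simp add: uu' v u_def[symmetric] power2_eq_square power_mult_distrib)
      qed
      have u2: "u\<^sup>2 * u'\<^sup>2 = 1" by (simp add: uu' flip: power_mult_distrib)
      have "u ^ (d + 2) * 2 ^ d * (LINT x|lborel. T m x) =
         (u ^ d * u ^ m * u' ^ (d - m)) * (\<kappa> m * (u\<^sup>2 * plane_moment C m (d - m) / 2
           - u\<^sup>2 * u\<^sup>2 * plane_moment A m (d - m) / 4 - u\<^sup>2 * u'\<^sup>2 * plane_moment B m (d - m) / 4))"
      proof -
        have cancel: "u ^ d * u\<^sup>2 * D * (n / D * e * um * un * P) = (u ^ d * um * un) * (n * e * (u\<^sup>2 * P))"
          if "D \<noteq> 0" for D n e um un P
          using that by simp
        have dist: "w * (z / 2 - w * z1 / 4 - w' * z2 / 4) = w * z / 2 - w * w * z1 / 4 - w * w' * z2 / 4"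
          for z z1 z2 w w' :: complex
          by (simp add: field_simps)
        show ?thesis
          unfolding LT power_add \<kappa>_def dist[symmetric] by (rule cancel) simp
      qed
      also have "\<dots> = v ^ m * (\<alpha> m * v + \<beta> m * v\<^sup>2 + \<gamma> m)"
      proof -
        have "K * (w * z / 2 - w * w * z1 / 4 - 1 * z2 / 4) = K * (z / 2) * w + - K * (z1 / 4) * w\<^sup>2 + - K * (z2 / 4)"
          for K w z z1 z2 :: complex
          by (simp add: field_simps power2_eq_square)
        then show ?thesis
          unfolding ud u2 v u_def[symmetric] \<alpha>_def \<beta>_def \<gamma>_def by (simp only:)
      qed
      finally show "u ^ (d + 2) * 2 ^ d * (LINT x|lborel. T m x) = v ^ m * (\<alpha> m * v + \<beta> m * v\<^sup>2 + \<gamma> m)" .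
    qed
    finally show ?thesis by simp
  qed
  have "\<alpha> (p + 1) + \<beta> p + \<gamma> (p + 2) = 0"
    by (rule shifted_polynomial_coefficients_zero[OF infinite_double_angle_phases zero]) (simp_all add: d_def)
  moreover have "d - (p + 1) = q + 1" "d - p = q + 2" "d - (p + 2) = q" by (simp_all add: d_def)
  ultimately show ?thesis
    by (simp only: \<alpha>_def \<beta>_def \<gamma>_def \<kappa>_def B_def[abs_def] diff_conv_add_uminus mult_minus_left)
qed

text \<open>
  The three Gaussian moments in a relation share the factor \<open>(1 - \<i> y)\<^sup>p (1 + \<i> y)\<^sup>q\<close>, and the rest is the
  quadratic \<open>(1 + y\<^sup>2) C - (1 + \<i> y)\<^sup>2 A - (1 - \<i> y)\<^sup>2 B\<close>. Its coefficients determine \<open>A\<close>, \<open>B\<close> and \<open>C\<close>. The case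
  \<open>p > q\<close> is the complex conjugate of the case \<open>q > p\<close>.
\<close>

lemma quadratic_vanishes_if_relations:
  assumes c: "c > 0"
  shows "\<exists>N. \<forall>p q. N \<le> p \<longrightarrow> N \<le> q \<longrightarrow> q = p + j \<or> p = q + j \<longrightarrow> (\<forall>A B C.
    (\<forall>k\<in>{0, 1, 2}. cayley_gauss_moment c k (p + 1) (q + 1) * C
       - cayley_gauss_moment c k p (q + 2) * A - cayley_gauss_moment c k (p + 2) q * B = 0)
    \<longrightarrow> A = 0 \<and> B = 0 \<and> C = 0)"
proof -
  obtain N where N: "\<And>n p\<^sub>0 p\<^sub>1 p\<^sub>2. n \<ge> N \<Longrightarrow>
    (\<forall>k\<in>{0, 1, 2}. (LINT y|lborel. gauss_weight c y *\<^sub>R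
        (of_real y ^ k * ((1 + (of_real y)\<^sup>2) ^ n * (1 + \<i> * of_real y) ^ j * (p\<^sub>0 + p\<^sub>1 * of_real y + p\<^sub>2 * (of_real y)\<^sup>2)))) = 0)
    \<Longrightarrow> p\<^sub>0 = 0 \<and> p\<^sub>1 = 0 \<and> p\<^sub>2 = 0"
    using gaussian_quadratic_orthogonality[OF c, of j] by blast
  show ?thesis
  proof (intro exI[of _ N] allI impI)
    fix p q and A B C :: complex
    assume pq: "N \<le> p" "N \<le> q" and j: "q = p + j \<or> p = q + j"
      and rel: "\<forall>k\<in>{0, 1, 2}. cayley_gauss_moment c k (p + 1) (q + 1) * C
       - cayley_gauss_moment c k p (q + 2) * A - cayley_gauss_moment c k (p + 2) q * B = 0"
    define p\<^sub>0 p\<^sub>1 p\<^sub>2 where "p\<^sub>0 = C - A - B" and "p\<^sub>1 = 2 * \<i> * (B - A)" and "p\<^sub>2 = C + A + B"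
    define w where "w y = (1 - \<i> * of_real y) ^ p * (1 + \<i> * of_real y) ^ q" for y :: real
    have E: "(LINT y|lborel. gauss_weight c y *\<^sub>R (of_real y ^ k * (w y * (p\<^sub>0 + p\<^sub>1 * of_real y + p\<^sub>2 * (of_real y)\<^sup>2)))) = 0"
      if "k \<in> {0, 1, 2}" for k
    proof -
      have poly: "p\<^sub>0 + p\<^sub>1 * of_real y + p\<^sub>2 * (of_real y)\<^sup>2 =
         (1 - \<i> * of_real y) * (1 + \<i> * of_real y) * C - (1 + \<i> * of_real y)\<^sup>2 * A - (1 - \<i> * of_real y)\<^sup>2 * B" for y :: real
        by (simp add: p\<^sub>0_def p\<^sub>1_def p\<^sub>2_def complex_eq_iff power2_eq_square algebra_simps)
      define I where "I m n y = gauss_weight c y *\<^sub>R (of_real y ^ k * ((1 - \<i> * of_real y) ^ m * (1 + \<i> * of_real y) ^ n))" for m n y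
      have intI: "integrable lborel (I m n)" for m n
        unfolding I_def[abs_def] by (rule integrable_cayley_gauss[OF c])
      have "gauss_weight c y *\<^sub>R (of_real y ^ k * (w y * (p\<^sub>0 + p\<^sub>1 * of_real y + p\<^sub>2 * (of_real y)\<^sup>2))) =
        I (p + 1) (q + 1) y * C - I p (q + 2) y * A - I (p + 2) q y * B" for y
        unfolding poly I_def w_def scaleR_conv_of_real by (simp add: power_add power2_eq_square algebra_simps)
      then have "(LINT y|lborel. gauss_weight c y *\<^sub>R (of_real y ^ k * (w y * (p\<^sub>0 + p\<^sub>1 * of_real y + p\<^sub>2 * (of_real y)\<^sup>2)))) =
        (LINT y|lborel. I (p + 1) (q + 1) y) * C - (LINT y|lborel. I p (q + 2) y) * A - (LINT y|lborel. I (p + 2) q y) * B"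
        using intI by simp
      also have "\<dots> = 0"
        using rel that unfolding cayley_gauss_moment_def I_def by blast
      finally show ?thesis .
    qed
    have intE: "integrable lborel (\<lambda>y. gauss_weight c y *\<^sub>R (of_real y ^ k * (w y * (p\<^sub>0 + p\<^sub>1 * of_real y + p\<^sub>2 * (of_real y)\<^sup>2))))" for k
      unfolding w_def
      by (intro integrable_gauss_weight c continuous_intros polynomially_bounded_intros polynomially_bounded_power)
    have sq: "(1 - \<i> * of_real y) * (1 + \<i> * of_real y) = 1 + (of_real y)\<^sup>2" for y :: real
      by (simp add: complex_eq_iff power2_eq_square)
    from j have "p\<^sub>0 = 0 \<and> p\<^sub>1 = 0 \<and> p\<^sub>2 = 0"
    proof
      assume q: "q = p + j"
      have "w y = (1 + (of_real y)\<^sup>2) ^ p * (1 + \<i> * of_real y) ^ j" for y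
        unfolding w_def q sq[symmetric] by (simp add: power_add power_mult_distrib mult_ac)
      then show ?thesis using E by (intro N[OF pq(1)]) simp
    next
      assume p: "p = q + j"
      have "w y = (1 + (of_real y)\<^sup>2) ^ q * (1 - \<i> * of_real y) ^ j" for y
        unfolding w_def p sq[symmetric] by (simp add: power_add power_mult_distrib mult_ac)
      then have w: "cnj (w y) = (1 + (of_real y)\<^sup>2) ^ q * (1 + \<i> * of_real y) ^ j" for y
        by simp
      have "cnj p\<^sub>0 = 0 \<and> cnj p\<^sub>1 = 0 \<and> cnj p\<^sub>2 = 0"
      proof (rule N[OF pq(2)], intro ballI)
        fix k :: nat assume k: "k \<in> {0, 1, 2}"
        have "(LINT y|lborel. gauss_weight c y *\<^sub>R
          (of_real y ^ k * ((1 + (of_real y)\<^sup>2) ^ q * (1 + \<i> * of_real y) ^ j * (cnj p\<^sub>0 + cnj p\<^sub>1 * of_real y + cnj p\<^sub>2 * (of_real y)\<^sup>2))))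
          = (LINT y|lborel. cnj (gauss_weight c y *\<^sub>R (of_real y ^ k * (w y * (p\<^sub>0 + p\<^sub>1 * of_real y + p\<^sub>2 * (of_real y)\<^sup>2)))))"
          by (rule Bochner_Integration.integral_cong[OF refl]) (simp add: w[symmetric])
        also have "\<dots> = cnj (LINT y|lborel. gauss_weight c y *\<^sub>R (of_real y ^ k * (w y * (p\<^sub>0 + p\<^sub>1 * of_real y + p\<^sub>2 * (of_real y)\<^sup>2))))"
          by (rule integral_bounded_linear[OF bounded_linear_cnj]) (rule intE)
        also have "\<dots> = 0" using E[OF k] by simp
        finally show "(LINT y|lborel. gauss_weight c y *\<^sub>R
          (of_real y ^ k * ((1 + (of_real y)\<^sup>2) ^ q * (1 + \<i> * of_real y) ^ j * (cnj p\<^sub>0 + cnj p\<^sub>1 * of_real y + cnj p\<^sub>2 * (of_real y)\<^sup>2)))) = 0" .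
      qed
      then show ?thesis by simp
    qed
    then have *: "C - A - B = 0" "B - A = 0" "C + A + B = 0"
      by (auto simp: p\<^sub>0_def p\<^sub>1_def p\<^sub>2_def)
    have "A = B" using *(2) by simp
    moreover have "C = A + B" using *(1) by (simp add: algebra_simps)
    ultimately show "A = 0 \<and> B = 0 \<and> C = 0" using *(3) by simp
  qed
qed

section \<open>Recovering the tensor field\<close>

text \<open>
  Up to binomial coefficients, which are nonzero, the moments of \<open>A\<close>, \<open>C\<close> and the conjugate of \<open>A\<close> satisfy
  the relations above for \<open>k = 0, 1, 2\<close>. So they vanish as soon as both exponents are large compared with
  a bound that depends only on their difference.
\<close>

lemma plane_tensor_zero_if_gaussian_data_zero:
  fixes A C :: "real^2 \<Rightarrow> complex" and F :: "real \<Rightarrow> real^2 \<Rightarrow> real"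
  assumes c: "c > 0"
    and A: "continuous_on UNIV A" "\<And>x. norm x \<ge> 1 \<Longrightarrow> A x = 0"
    and C: "continuous_on UNIV C" "\<And>x. norm x \<ge> 1 \<Longrightarrow> C x = 0"
    and F: "\<And>\<theta> x. of_real (F \<theta> x) = C x / 2 - (cis (- \<theta>) ^ 2 * A x + cis \<theta> ^ 2 * cnj (A x)) / 4"
    and data: "\<And>k d \<theta>. k \<in> {0, 1, 2} \<Longrightarrow> \<theta> \<in> {0..<2 * pi} \<Longrightarrow>
      (LINT x|lborel. F \<theta> x * (LINT y|lborel. y ^ k * gauss_weight c y * (dir \<theta> \<bullet> x + y * (dir_perp \<theta> \<bullet> x)) ^ d)) = 0"
  shows "A = (\<lambda>x. 0)" "C = (\<lambda>x. 0)"
proof -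
  have "\<exists>N. \<forall>p q. N \<le> p \<longrightarrow> N \<le> q \<longrightarrow> q = p + j \<or> p = q + j \<longrightarrow>
      plane_moment A p (q + 2) = 0 \<and> plane_moment C (p + 1) (q + 1) = 0" for j
  proof -
    obtain N where N: "\<forall>p q. N \<le> p \<longrightarrow> N \<le> q \<longrightarrow> q = p + j \<or> p = q + j \<longrightarrow> (\<forall>A B C.
      (\<forall>k\<in>{0, 1, 2}. cayley_gauss_moment c k (p + 1) (q + 1) * C
         - cayley_gauss_moment c k p (q + 2) * A - cayley_gauss_moment c k (p + 2) q * B = 0)
      \<longrightarrow> A = 0 \<and> B = 0 \<and> C = 0)"
      using quadratic_vanishes_if_relations[OF c, of j] by blast
    show ?thesis
    proof (intro exI[of _ N] allI impI)
      fix p q assume pq: "N \<le> p" "N \<le> q" "q = p + j \<or> p = q + j"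
      define d where "d = p + q + 2"
      let ?A = "of_nat (d choose p) * (plane_moment A p (q + 2) / 4)"
        and ?B = "of_nat (d choose (p + 2)) * (plane_moment (\<lambda>x. cnj (A x)) (p + 2) q / 4)"
        and ?C = "of_nat (d choose (p + 1)) * (plane_moment C (p + 1) (q + 1) / 2)"
      have "cayley_gauss_moment c k (p + 1) (q + 1) * ?C
         - cayley_gauss_moment c k p (q + 2) * ?A - cayley_gauss_moment c k (p + 2) q * ?B = 0" if "k \<in> {0, 1, 2}" for k
        using tensor_moment_relations[OF c A C F data[OF that], of p q] unfolding d_def
        by (simp only: mult_ac)
      then have "?A = 0 \<and> ?B = 0 \<and> ?C = 0"
        by (rule N[rule_format, OF pq])
      moreover have "d choose p > 0" "d choose (p + 1) > 0"
        by (rule zero_less_binomial, simp add: d_def)+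
      ultimately show "plane_moment A p (q + 2) = 0 \<and> plane_moment C (p + 1) (q + 1) = 0"
        by simp
    qed
  qed
  then obtain N where N: "\<And>j p q. N j \<le> p \<Longrightarrow> N j \<le> q \<Longrightarrow> q = p + j \<or> p = q + j \<Longrightarrow>
      plane_moment A p (q + 2) = 0 \<and> plane_moment C (p + 1) (q + 1) = 0"
    by metis
  show "A = (\<lambda>x. 0)"
  proof (rule continuous_eq_0_if_high_plane_moments_zero[OF A])
    fix j :: nat
    \<comment> \<open>The moments of \<open>A\<close> enter with exponents \<open>(p, q + 2)\<close>, so the differences \<open>j\<close> and \<open>- j\<close> of the exponents
      belong to \<open>p - q = j + 2\<close> and \<open>p - q = 2 - j\<close>.\<close>
    define j' where "j' = (if j \<ge> 2 then j - 2 else 2 - j)"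
    show "\<exists>M. \<forall>n\<ge>M. plane_moment A (j + n) n = 0 \<and> plane_moment A n (j + n) = 0"
    proof (intro exI[of _ "N (j + 2) + N j' + 2"] allI impI conjI)
      fix n assume n: "N (j + 2) + N j' + 2 \<le> n"
      define m where "m = n - 2"
      have m: "n = m + 2" "N (j + 2) \<le> m" "N j' \<le> m" using n by (simp_all add: m_def)
      show "plane_moment A (j + n) n = 0"
        using N[of "j + 2" "j + n" m] m(1,2) by auto
      have "j + m = n + j' \<or> n = j + m + j'" using m(1) by (auto simp: j'_def)
      then have "plane_moment A n (j + m + 2) = 0" using N[of j' n "j + m"] m by simp
      moreover have "j + n = j + m + 2" using m(1) by simp
      ultimately show "plane_moment A n (j + n) = 0" by simp
    qed
  qed
  show "C = (\<lambda>x. 0)"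
  proof (rule continuous_eq_0_if_high_plane_moments_zero[OF C])
    fix j :: nat
    show "\<exists>M. \<forall>n\<ge>M. plane_moment C (j + n) n = 0 \<and> plane_moment C n (j + n) = 0"
    proof (intro exI[of _ "N j + 1"] allI impI conjI)
      fix n assume n: "N j + 1 \<le> n"
      define m where "m = n - 1"
      have m: "n = m + 1" "N j \<le> m" using n by (simp_all add: m_def)
      show "plane_moment C (j + n) n = 0"
        using N[of j "j + m" m] m by simp
      show "plane_moment C n (j + n) = 0"
        using N[of j m "j + m"] m by simp
    qed
  qed
qed

text \<open>
  In terms of the double angle, \<open>F\<^sub>\<theta> = C / 2 - Re (cis (- 2 \<theta>) A) / 2\<close>, where \<open>A\<close> is the trace-free part
  of the tensor and \<open>C\<close> its trace.
\<close>

lemma beam_data_determine_tensor: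
  fixes g\<^sub>1\<^sub>1 g\<^sub>1\<^sub>2 g\<^sub>2\<^sub>2 :: "real^2 \<Rightarrow> real"
  assumes w: "w0 > 0" "lam > 0"
    and cont: "continuous_on UNIV g\<^sub>1\<^sub>1" "continuous_on UNIV g\<^sub>1\<^sub>2" "continuous_on UNIV g\<^sub>2\<^sub>2"
    and supp: "\<And>x. norm x \<ge> 1 \<Longrightarrow> g\<^sub>1\<^sub>1 x = 0 \<and> g\<^sub>1\<^sub>2 x = 0 \<and> g\<^sub>2\<^sub>2 x = 0"
    and data: "\<And>k s \<theta>. k \<in> {0, 1, 2} \<Longrightarrow> \<theta> \<in> {0..<2 * pi} \<Longrightarrow>
      (LINT x|lborel. (dir_perp \<theta> \<bullet> x) ^ k * beam_kernel w0 lam (s - dir \<theta> \<bullet> x) (dir_perp \<theta> \<bullet> x)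
         * ((sin \<theta>)\<^sup>2 * g\<^sub>1\<^sub>1 x - 2 * sin \<theta> * cos \<theta> * g\<^sub>1\<^sub>2 x + (cos \<theta>)\<^sup>2 * g\<^sub>2\<^sub>2 x)) = 0"
  shows "g\<^sub>1\<^sub>1 x = 0" "g\<^sub>1\<^sub>2 x = 0" "g\<^sub>2\<^sub>2 x = 0"
proof -
  define c where "c = beam_spread w0 lam"
  define F where "F \<theta> x = (sin \<theta>)\<^sup>2 * g\<^sub>1\<^sub>1 x - 2 * sin \<theta> * cos \<theta> * g\<^sub>1\<^sub>2 x + (cos \<theta>)\<^sup>2 * g\<^sub>2\<^sub>2 x" for \<theta> x
  define A where "A x = Complex (g\<^sub>1\<^sub>1 x - g\<^sub>2\<^sub>2 x) (2 * g\<^sub>1\<^sub>2 x)" for x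
  define C where "C x = complex_of_real (g\<^sub>1\<^sub>1 x + g\<^sub>2\<^sub>2 x)" for x
  have c: "c > 0" unfolding c_def by (rule beam_spread_pos[OF w])
  have cF: "continuous_on UNIV (F \<theta>)" and zF: "norm x \<ge> 1 \<Longrightarrow> F \<theta> x = 0" for \<theta> x
    unfolding F_def[abs_def] using supp[of x] by (auto intro!: continuous_intros cont)
  have cA: "continuous_on UNIV A" unfolding A_def[abs_def] Complex_eq by (intro continuous_intros cont)
  have zA: "norm x \<ge> 1 \<Longrightarrow> A x = 0" for x using supp[of x] by (simp add: A_def complex_eq_iff)
  have cC: "continuous_on UNIV C" unfolding C_def[abs_def] by (intro continuous_intros cont)
  have zC: "norm x \<ge> 1 \<Longrightarrow> C x = 0" for x using supp[of x] by (simp add: C_def)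
  have FAC: "of_real (F \<theta> x) = C x / 2 - (cis (- \<theta>) ^ 2 * A x + cis \<theta> ^ 2 * cnj (A x)) / 4" for \<theta> x
  proof -
    have s: "(sin \<theta>)\<^sup>2 = (1 - cos (2 * \<theta>)) / 2" "(cos \<theta>)\<^sup>2 = (1 + cos (2 * \<theta>)) / 2" "2 * sin \<theta> * cos \<theta> = sin (2 * \<theta>)"
      by (simp_all add: sin_double cos_double_cos cos_squared_eq)
    show ?thesis
      unfolding F_def s Complex.DeMoivre by (simp add: A_def C_def complex_eq_iff field_simps)
  qed
  have gd: "(LINT x|lborel. F \<theta> x * (LINT y|lborel. y ^ k * gauss_weight c y * (dir \<theta> \<bullet> x + y * (dir_perp \<theta> \<bullet> x)) ^ d)) = 0"
    if k: "k \<in> {0, 1, 2}" and \<theta>: "\<theta> \<in> {0..<2 * pi}" for k d \<theta>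
  proof (rule gaussian_averaged_moments_zero[OF c cF zF _ _ _ k])
    show cdir: "continuous_on UNIV (\<lambda>x. dir \<theta> \<bullet> x)" "continuous_on UNIV (\<lambda>x. dir_perp \<theta> \<bullet> x)"
      by (intro continuous_intros)+
    show "(LINT x|lborel. F \<theta> x * (dir_perp \<theta> \<bullet> x) ^ k * exp (t * (dir \<theta> \<bullet> x) + c * t\<^sup>2 * (dir_perp \<theta> \<bullet> x)\<^sup>2)) = 0"
      if "k \<in> {0, 1, 2}" for t k
      unfolding c_def
      by (rule exponential_data_zero[OF w cF zF cdir]) (auto simp: F_def intro!: data[OF that \<theta>])
  qed
  have "A = (\<lambda>x. 0)" "C = (\<lambda>x. 0)"
    using plane_tensor_zero_if_gaussian_data_zero[of c A C F] c cA zA cC zC FAC gd by blast+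
  then have "A x = 0" "C x = 0" by simp_all
  then show "g\<^sub>1\<^sub>1 x = 0" "g\<^sub>1\<^sub>2 x = 0" "g\<^sub>2\<^sub>2 x = 0"
    by (simp_all add: A_def C_def complex_eq_iff flip: of_real_add)
qed

lemma test_function_on_unit_disk:
  assumes "test_function_on unit_disk g"
  shows "continuous_on UNIV g" and "norm x \<ge> 1 \<Longrightarrow> g x = 0"
proof -
  have "higher_differentiable_on unit_disk g 0" and supp: "closure {x. g x \<noteq> 0} \<subseteq> unit_disk"
    using assms unfolding test_function_on_def smooth_on_def by blast+
  then have disk: "continuous_on unit_disk g" by simp
  have outside: "g x = 0" if "x \<notin> closure {x. g x \<noteq> 0}" for x
  proof (rule ccontr)
    assume "g x \<noteq> 0"
    then have "x \<in> {x. g x \<noteq> 0}" by simp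
    then have "x \<in> closure {x. g x \<noteq> 0}" by (rule subsetD[OF closure_subset])
    with that show False by contradiction
  qed
  have "continuous_on (- closure {x. g x \<noteq> 0}) g"
  proof (rule continuous_on_eq[where f = "\<lambda>_. 0"])
    show "0 = g x" if "x \<in> - closure {x. g x \<noteq> 0}" for x
      by (rule outside[symmetric]) (rule ComplD[OF that])
  qed (rule continuous_on_const)
  with disk have "continuous_on (unit_disk \<union> - closure {x. g x \<noteq> 0}) g"
    by (intro continuous_on_open_Un) (auto simp: unit_disk_def)
  also have "unit_disk \<union> - closure {x. g x \<noteq> 0} = UNIV" using supp by blast
  finally show "continuous_on UNIV g" .
  assume "norm x \<ge> 1"
  then have "x \<notin> closure {x. g x \<noteq> 0}" using supp by (auto simp: unit_disk_def)
  then show "g x = 0" by (rule outside)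
qed

lemma continuous_on_beam_kernel:
  assumes "w0 > 0" "continuous_on S a" "continuous_on S b"
  shows "continuous_on S (\<lambda>x. beam_kernel w0 lam (a x) (b x))"
proof -
  have "1 + (b x / rayleigh_range w0 lam)\<^sup>2 > 0" for x by (simp add: add_pos_nonneg)
  then have nz: "beam_width w0 lam (b x) \<noteq> 0" for x
    unfolding beam_width_def using assms(1) by (metis mult_eq_0_iff order_less_irrefl real_sqrt_eq_zero_cancel_iff)
  have cw: "continuous_on S (\<lambda>x. beam_width w0 lam (b x))"
    unfolding beam_width_def divide_inverse by (intro continuous_intros assms(3))
  show ?thesis
    unfolding beam_kernel_def by (intro continuous_intros assms(2) cw) (simp_all add: nz)
qed

theorem theorem4:
  fixes w0 lam :: real and f h :: "real^2 \<Rightarrow> real^2^2"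
  assumes "w0 > 0" and "lam > 0"
    and "f \<in> symmetric_tensor_fields unit_disk"
    and "h \<in> symmetric_tensor_fields unit_disk"
  shows "((\<forall>k\<in>{0, 1, 2}. \<forall>s. \<forall>\<theta>\<in>{0..<2 * pi}.
             longitudinal_transform w0 lam k f s \<theta> = longitudinal_transform w0 lam k h s \<theta>)
           \<longrightarrow> f = h) \<and>
         ((\<forall>k\<in>{0, 1, 2}. \<forall>s. \<forall>\<theta>\<in>{0..<2 * pi}.
             transverse_transform w0 lam k f s \<theta> = transverse_transform w0 lam k h s \<theta>)
           \<longrightarrow> f = h)"
proof -
  define g where "g i j x = f x $ i $ j - h x $ i $ j" for i j x
  have symm: "f x $ 2 $ 1 = f x $ 1 $ 2" "h x $ 2 $ 1 = h x $ 1 $ 2" for x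
    using assms(3,4) by (auto simp: symmetric_tensor_fields_def)
  have test: "test_function_on unit_disk (\<lambda>x. f x $ i $ j)" "test_function_on unit_disk (\<lambda>x. h x $ i $ j)" for i j
    using assms(3,4) by (auto simp: symmetric_tensor_fields_def)
  note ft = test_function_on_unit_disk[OF test(1)] and ht = test_function_on_unit_disk[OF test(2)]
  have cg: "continuous_on UNIV (g i j)" and zg: "norm x \<ge> 1 \<Longrightarrow> g i j x = 0" for i j x
    unfolding g_def[abs_def] by (intro continuous_on_diff ft(1) ht(1)) (simp add: ft(2) ht(2))
  have fh: "f = h" if "\<And>x. g 1 1 x = 0" "\<And>x. g 1 2 x = 0" "\<And>x. g 2 2 x = 0"
    using that symm by (simp add: g_def fun_eq_iff vec_eq_iff forall_2)
  have diff: "(LINT x|lborel. (dir_perp \<theta> \<bullet> x) ^ k * beam_kernel w0 lam (s - dir \<theta> \<bullet> x) (dir_perp \<theta> \<bullet> x)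
        * (\<Sum>i\<in>UNIV. \<Sum>j\<in>UNIV. e $ i * e $ j * g i j x)) = 0"
    if "(LINT x|lborel. (dir_perp \<theta> \<bullet> x) ^ k * beam_kernel w0 lam (s - dir \<theta> \<bullet> x) (dir_perp \<theta> \<bullet> x)
        * (\<Sum>i\<in>UNIV. \<Sum>j\<in>UNIV. e $ i * e $ j * f x $ i $ j)) =
        (LINT x|lborel. (dir_perp \<theta> \<bullet> x) ^ k * beam_kernel w0 lam (s - dir \<theta> \<bullet> x) (dir_perp \<theta> \<bullet> x)
        * (\<Sum>i\<in>UNIV. \<Sum>j\<in>UNIV. e $ i * e $ j * h x $ i $ j))" for \<theta> k s and e :: "real^2"
  proof -
    have int: "integrable lborel (\<lambda>x. (dir_perp \<theta> \<bullet> x) ^ k * beam_kernel w0 lam (s - dir \<theta> \<bullet> x) (dir_perp \<theta> \<bullet> x)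
        * (\<Sum>i\<in>UNIV. \<Sum>j\<in>UNIV. e $ i * e $ j * u x $ i $ j))"
      if "\<And>i j. continuous_on UNIV (\<lambda>x. u x $ i $ j)" "\<And>i j x. norm x \<ge> 1 \<Longrightarrow> u x $ i $ j = 0"
      for u :: "real^2 \<Rightarrow> real^2^2"
    proof (rule integrable_continuous_vanishing_outside_ball)
      show "continuous_on UNIV (\<lambda>x. (dir_perp \<theta> \<bullet> x) ^ k * beam_kernel w0 lam (s - dir \<theta> \<bullet> x) (dir_perp \<theta> \<bullet> x)
          * (\<Sum>i\<in>UNIV. \<Sum>j\<in>UNIV. e $ i * e $ j * u x $ i $ j))"
        by (intro continuous_on_mult continuous_on_sum continuous_on_beam_kernel continuous_on_power
            continuous_on_inner continuous_on_diff continuous_on_const continuous_on_id assms that(1))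
    qed (simp add: that(2))
    show ?thesis
      using that Bochner_Integration.integral_diff[OF int[of f, OF ft] int[of h, OF ht]]
      by (simp add: g_def right_diff_distrib sum_subtractf)
  qed
  show ?thesis
  proof (intro conjI impI)
    assume L: "\<forall>k\<in>{0, 1, 2}. \<forall>s. \<forall>\<theta>\<in>{0..<2 * pi}.
             longitudinal_transform w0 lam k f s \<theta> = longitudinal_transform w0 lam k h s \<theta>"
    have data: "(LINT x|lborel. (dir_perp \<theta> \<bullet> x) ^ k * beam_kernel w0 lam (s - dir \<theta> \<bullet> x) (dir_perp \<theta> \<bullet> x)
         * ((sin \<theta>)\<^sup>2 * g 1 1 x - 2 * sin \<theta> * cos \<theta> * g 1 2 x + (cos \<theta>)\<^sup>2 * g 2 2 x)) = 0"
      if "k \<in> {0, 1, 2}" "\<theta> \<in> {0..<2 * pi}" for k s \<theta>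
    proof -
      have eq: "(\<Sum>i\<in>UNIV. \<Sum>j\<in>UNIV. dir_perp \<theta> $ i * dir_perp \<theta> $ j * g i j x) =
          (sin \<theta>)\<^sup>2 * g 1 1 x - 2 * sin \<theta> * cos \<theta> * g 1 2 x + (cos \<theta>)\<^sup>2 * g 2 2 x" for x
        by (simp add: sum_2 dir_perp_def g_def symm power2_eq_square algebra_simps)
      have "longitudinal_transform w0 lam k f s \<theta> = longitudinal_transform w0 lam k h s \<theta>"
        using L that by blast
      from diff[OF this[unfolded longitudinal_transform_def]] show ?thesis by (simp only: eq)
    qed
    have "g 1 1 x = 0 \<and> g 1 2 x = 0 \<and> g 2 2 x = 0" for x
      using beam_data_determine_tensor[of w0 lam "g 1 1" "g 1 2" "g 2 2", OF assms(1,2) cg cg cg _ data] zg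
      by blast
    then show "f = h" by (intro fh) blast+
  next
    assume T: "\<forall>k\<in>{0, 1, 2}. \<forall>s. \<forall>\<theta>\<in>{0..<2 * pi}.
             transverse_transform w0 lam k f s \<theta> = transverse_transform w0 lam k h s \<theta>"
    have data: "(LINT x|lborel. (dir_perp \<theta> \<bullet> x) ^ k * beam_kernel w0 lam (s - dir \<theta> \<bullet> x) (dir_perp \<theta> \<bullet> x)
         * ((sin \<theta>)\<^sup>2 * g 2 2 x - 2 * sin \<theta> * cos \<theta> * (- g 1 2 x) + (cos \<theta>)\<^sup>2 * g 1 1 x)) = 0"
      if "k \<in> {0, 1, 2}" "\<theta> \<in> {0..<2 * pi}" for k s \<theta>
    proof -
      have eq: "(\<Sum>i\<in>UNIV. \<Sum>j\<in>UNIV. dir \<theta> $ i * dir \<theta> $ j * g i j x) =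
          (sin \<theta>)\<^sup>2 * g 2 2 x - 2 * sin \<theta> * cos \<theta> * (- g 1 2 x) + (cos \<theta>)\<^sup>2 * g 1 1 x" for x
        by (simp add: sum_2 dir_def g_def symm power2_eq_square algebra_simps)
      have "transverse_transform w0 lam k f s \<theta> = transverse_transform w0 lam k h s \<theta>"
        using T that by blast
      from diff[OF this[unfolded transverse_transform_def]] show ?thesis by (simp only: eq)
    qed
    have "g 2 2 x = 0 \<and> - g 1 2 x = 0 \<and> g 1 1 x = 0" for x
      using beam_data_determine_tensor[of w0 lam "g 2 2" "\<lambda>x. - g 1 2 x" "g 1 1",
          OF assms(1,2) cg continuous_on_minus[OF cg] cg _ data] zg
      by simp
    then show "f = h" by (intro fh) simp_all
  qed
qed

end
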